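(* Let $\mathfrak s_n$ be a sequence of classical finite-dimensional simple complex Lie algebras of rank $n$ and of fixed type $A$, $B$, $C$ or $D$. Denote by $V_n$ the natural $\mathfrak s_n$-module. Then, for any fixed $a,b,c,k\in\mathbb Z_{>0}$, the length of the $\mathfrak s_n$-module $T^k(V_n^a\oplus(V_n^* )^b\oplus\mathbb C^c)$ stabilizes when $n\to\infty$ (i.e. is independent of $n$ for all sufficiently large $n$), where $\mathbb C$ stands for the trivial $1$-dimensional $\mathfrak s_n$-module.
   Context: $W^p$ denotes the direct sum of $p$ copies of $W$, and $T^k(W)=W^{\otimes k}$ is the $k$-th tensor power. *)

theory Defs
  imports
    "Jordan_Normal_Form.Matrix"
    "HOL-Library.Function_Algebras"
    "HOL-Library.Extended_Nat"
begin

section \<open>The classical Lie algebras\<close>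

datatype classical_type = Type_A | Type_B | Type_C | Type_D

text \<open>Dimension of the natural module of the algebra of rank \<open>n\<close>.\<close>

fun natural_dim :: "classical_type \<Rightarrow> nat \<Rightarrow> nat" where
  "natural_dim Type_A n = n + 1"
| "natural_dim Type_B n = 2 * n + 1"
| "natural_dim Type_C n = 2 * n"
| "natural_dim Type_D n = 2 * n"

definition sl_algebra :: "nat \<Rightarrow> complex mat set" where
  "sl_algebra N = {X \<in> carrier_mat N N. (\<Sum>i<N. X $$ (i, i)) = 0}"

text \<open>The matrices that are skew with respect to the bilinear form with Gram matrix \<open>J\<close>.\<close>

definition form_algebra :: "nat \<Rightarrow> complex mat \<Rightarrow> complex mat set" where
  "form_algebra N J = {X \<in> carrier_mat N N. transpose_mat X * J + J * X = 0\<^sub>m N N}"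

text \<open>
  Over the complex numbers a non-degenerate symmetric (or alternating) form is unique up to
  a change of basis; we take the forms with antidiagonal Gram matrix, for which the upper
  triangular matrices of the algebra form a Borel subalgebra.
\<close>

definition sym_form :: "nat \<Rightarrow> complex mat" where
  "sym_form N = mat N N (\<lambda>(i, j). if i + j + 1 = N then 1 else 0)"

definition alt_form :: "nat \<Rightarrow> complex mat" where
  "alt_form N = mat N N (\<lambda>(i, j). if i + j + 1 = N then (if i < j then 1 else - 1) else 0)"

fun classical_algebra :: "classical_type \<Rightarrow> nat \<Rightarrow> complex mat set" where
  "classical_algebra Type_A n = sl_algebra (n + 1)"
| "classical_algebra Type_B n = form_algebra (2 * n + 1) (sym_form (2 * n + 1))"
| "classical_algebra Type_C n = form_algebra (2 * n) (alt_form (2 * n))"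
| "classical_algebra Type_D n = form_algebra (2 * n) (sym_form (2 * n))"


section \<open>Modules\<close>

text \<open>
  A finite-dimensional module is given on the space of functions \<open>'i \<Rightarrow> complex\<close> vanishing
  outside a finite index set; \<open>f\<close> stands for the vector with coordinates \<open>f i\<close> in a basis
  labelled by that set.  This lets the dimension depend on \<open>n\<close>.
\<close>

record 'i lie_mod =
  indices :: "'i set"
  action :: "complex mat \<Rightarrow> ('i \<Rightarrow> complex) \<Rightarrow> 'i \<Rightarrow> complex"

definition vspace :: "('i, 'z) lie_mod_scheme \<Rightarrow> ('i \<Rightarrow> complex) set" where
  "vspace M = {f. \<forall>i. i \<notin> indices M \<longrightarrow> f i = 0}"

definition unit_fun :: "'i \<Rightarrow> 'i \<Rightarrow> complex" where
  "unit_fun i = (\<lambda>j. if j = i then 1 else 0)"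

definition fscale :: "complex \<Rightarrow> ('i \<Rightarrow> complex) \<Rightarrow> 'i \<Rightarrow> complex" where
  "fscale c f = (\<lambda>i. c * f i)"

global_interpretation fscale: vector_space fscale
  by unfold_locales (auto simp: fscale_def fun_eq_iff algebra_simps)

definition lie_module :: "complex mat set \<Rightarrow> 'i lie_mod \<Rightarrow> bool" where
  "lie_module L M \<longleftrightarrow> finite (indices M) \<and>
     (\<forall>X\<in>L. \<forall>f\<in>vspace M. action M X f \<in> vspace M) \<and>
     (\<forall>X\<in>L. \<forall>f\<in>vspace M. \<forall>g\<in>vspace M. action M X (f + g) = action M X f + action M X g) \<and>
     (\<forall>X\<in>L. \<forall>c. \<forall>f\<in>vspace M. action M X (fscale c f) = fscale c (action M X f)) \<and>
     (\<forall>X\<in>L. \<forall>Y\<in>L. \<forall>f\<in>vspace M. action M (X + Y) f = action M X f + action M Y f) \<and>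
     (\<forall>X\<in>L. \<forall>c. \<forall>f\<in>vspace M. action M (c \<cdot>\<^sub>m X) f = fscale c (action M X f)) \<and>
     (\<forall>X\<in>L. \<forall>Y\<in>L. \<forall>f\<in>vspace M.
        action M (X * Y - Y * X) f = action M X (action M Y f) - action M Y (action M X f))"

definition natural_module :: "nat \<Rightarrow> nat lie_mod" where
  "natural_module N = \<lparr>indices = {..<N},
     action = (\<lambda>X v i. if i < N then \<Sum>j<N. X $$ (i, j) * v j else 0)\<rparr>"

definition trivial_module :: "unit lie_mod" where
  "trivial_module = \<lparr>indices = UNIV, action = (\<lambda>X f i. 0)\<rparr>"

text \<open>
  In coordinates with respect to the dual basis: \<open>(X \<phi>)(e\<^sub>i) = - \<phi> (X e\<^sub>i)\<close>;
  see \<open>dual_module_pairing\<close> below.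
\<close>

definition dual_module :: "'i lie_mod \<Rightarrow> 'i lie_mod" where
  "dual_module M = \<lparr>indices = indices M,
     action = (\<lambda>X \<phi> i. if i \<in> indices M
       then - (\<Sum>j\<in>indices M. \<phi> j * action M X (unit_fun i) j) else 0)\<rparr>"

definition direct_sum :: "'i lie_mod \<Rightarrow> 'j lie_mod \<Rightarrow> ('i + 'j) lie_mod" where
  "direct_sum M N = \<lparr>indices = indices M <+> indices N,
     action = (\<lambda>X f. case_sum (action M X (f \<circ> Inl)) (action N X (f \<circ> Inr)))\<rparr>"

definition direct_power :: "nat \<Rightarrow> 'i lie_mod \<Rightarrow> ('i \<times> nat) lie_mod" where
  "direct_power a M = \<lparr>indices = indices M \<times> {..<a},
     action = (\<lambda>X f (i, r). action M X (\<lambda>i'. f (i', r)) i)\<rparr>"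

text \<open>
  The tensors \<open>e\<^bsub>l ! 0\<^esub> \<otimes> \<dots> \<otimes> e\<^bsub>l ! (k - 1)\<^esub>\<close>, for lists \<open>l\<close> of \<open>k\<close> indices, form a basis of the
  \<open>k\<close>-th tensor power.  The \<open>p\<close>-th summand of the action is that of \<open>X\<close> on the \<open>p\<close>-th tensor
  factor, as made explicit by \<open>tensor_power_pure\<close> below.
\<close>

definition tensor_power :: "nat \<Rightarrow> 'i lie_mod \<Rightarrow> 'i list lie_mod" where
  "tensor_power k M = \<lparr>indices = {l. length l = k \<and> set l \<subseteq> indices M},
     action = (\<lambda>X t l. if length l = k \<and> set l \<subseteq> indices M
       then \<Sum>p<k. action M X (\<lambda>i. t (l[p := i])) (l ! p) else 0)\<rparr>"

definition pure_tensor :: "nat \<Rightarrow> (nat \<Rightarrow> 'i \<Rightarrow> complex) \<Rightarrow> 'i list \<Rightarrow> complex" where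
  "pure_tensor k w = (\<lambda>l. if length l = k then \<Prod>p<k. w p (l ! p) else 0)"


section \<open>Length\<close>

definition submodule :: "complex mat set \<Rightarrow> 'i lie_mod \<Rightarrow> ('i \<Rightarrow> complex) set \<Rightarrow> bool" where
  "submodule L M U \<longleftrightarrow> fscale.subspace U \<and> U \<subseteq> vspace M \<and> (\<forall>X\<in>L. \<forall>f\<in>U. action M X f \<in> U)"

text \<open>
  The supremum of the lengths of strict chains of submodules.  By the Jordan-Hoelder theorem
  it is the number of factors of any composition series; unlike that number, it needs no choice.
\<close>

definition module_length :: "complex mat set \<Rightarrow> 'i lie_mod \<Rightarrow> enat" where
  "module_length L M =
     (SUP m \<in> {m. \<exists>F. (\<forall>i\<le>m. submodule L M (F i)) \<and> (\<forall>i<m. F i \<subset> F (Suc i))}. enat m)"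


section \<open>Consistency of the definitions\<close>

lemma classical_algebra_carrier:
  "classical_algebra t n \<subseteq> carrier_mat (natural_dim t n) (natural_dim t n)"
  by (cases t) (auto simp: sl_algebra_def form_algebra_def)

lemma sl_algebra_bracket:
  assumes "X \<in> sl_algebra N" "Y \<in> sl_algebra N"
  shows "X * Y - Y * X \<in> sl_algebra N"
proof -
  have X: "X \<in> carrier_mat N N" and Y: "Y \<in> carrier_mat N N"
    using assms by (auto simp: sl_algebra_def)
  have "(\<Sum>i<N. (X * Y - Y * X) $$ (i, i)) =
      (\<Sum>i<N. (\<Sum>j<N. X $$ (i, j) * Y $$ (j, i)) - (\<Sum>j<N. Y $$ (i, j) * X $$ (j, i)))"
    using X Y by (intro sum.cong) (auto simp: scalar_prod_def atLeast0LessThan)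
  also have "\<dots> = (\<Sum>i<N. \<Sum>j<N. X $$ (i, j) * Y $$ (j, i)) -
      (\<Sum>i<N. \<Sum>j<N. X $$ (j, i) * Y $$ (i, j))"
    by (simp add: sum_subtractf mult.commute)
  also have "(\<Sum>i<N. \<Sum>j<N. X $$ (j, i) * Y $$ (i, j)) =
      (\<Sum>i<N. \<Sum>j<N. X $$ (i, j) * Y $$ (j, i))"
    by (rule sum.swap)
  finally show ?thesis using X Y by (auto simp: sl_algebra_def)
qed

lemma form_algebra_bracket:
  assumes J: "J \<in> carrier_mat N N" and "X \<in> form_algebra N J" "Y \<in> form_algebra N J"
  shows "X * Y - Y * X \<in> form_algebra N J"
proof -
  have X: "X \<in> carrier_mat N N" and Y: "Y \<in> carrier_mat N N"
    and eqs: "transpose_mat X * J + J * X = 0\<^sub>m N N" "transpose_mat Y * J + J * Y = 0\<^sub>m N N"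
    using assms by (auto simp: form_algebra_def)
  have skew: "transpose_mat Z * J = - (J * Z)"
    if Z: "Z \<in> carrier_mat N N" and e: "transpose_mat Z * J + J * Z = 0\<^sub>m N N" for Z
  proof (rule eq_matI)
    fix i j assume "i < dim_row (- (J * Z))" "j < dim_col (- (J * Z))"
    then have ij: "i < N" "j < N" using J Z by auto
    have "(transpose_mat Z * J + J * Z) $$ (i, j) = 0" using ij by (simp add: e)
    then show "(transpose_mat Z * J) $$ (i, j) = (- (J * Z)) $$ (i, j)"
      using ij J Z by (auto simp: eq_neg_iff_add_eq_0)
  qed (use J Z in auto)
  have prod: "transpose_mat (Z * W) * J = J * (W * Z)"
    if Z: "Z \<in> carrier_mat N N" and W: "W \<in> carrier_mat N N"
      and z: "transpose_mat Z * J = - (J * Z)" and w: "transpose_mat W * J = - (J * W)" for Z W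
  proof -
    have "transpose_mat (Z * W) * J = transpose_mat W * (transpose_mat Z * J)"
      using Z W J by (simp add: transpose_mult[OF Z W] assoc_mult_mat[of _ N N _ N _ N])
    also have "\<dots> = - ((transpose_mat W * J) * Z)"
      using Z W J by (simp add: z assoc_mult_mat[of _ N N _ N _ N] uminus_mult_right_mat)
    also have "\<dots> = J * W * Z"
      using Z W J by (simp add: w uminus_mult_left_mat)
    finally show ?thesis using Z W J by (simp add: assoc_mult_mat[of _ N N _ N _ N])
  qed
  have sx: "transpose_mat X * J = - (J * X)" and sy: "transpose_mat Y * J = - (J * Y)"
    using skew X Y eqs by auto
  have "transpose_mat (X * Y - Y * X) * J =
      transpose_mat (X * Y) * J - transpose_mat (Y * X) * J"
    using X Y J by (simp add: transpose_minus[of _ N N] minus_mult_distrib_mat[of _ N N _ _ N])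
  also have "\<dots> = J * (Y * X) - J * (X * Y)"
    using prod[OF X Y sx sy] prod[OF Y X sy sx] by simp
  finally have a: "transpose_mat (X * Y - Y * X) * J = J * (Y * X) - J * (X * Y)" .
  have b: "J * (X * Y - Y * X) = J * (X * Y) - J * (Y * X)"
    using X Y J by (simp add: mult_minus_distrib_mat[of _ N N _ N])
  have "transpose_mat (X * Y - Y * X) * J + J * (X * Y - Y * X) = 0\<^sub>m N N"
    unfolding a b using X Y J by (intro eq_matI) auto
  then show ?thesis using X Y by (auto simp: form_algebra_def)
qed

lemma classical_algebra_bracket:
  assumes "X \<in> classical_algebra t n" "Y \<in> classical_algebra t n"
  shows "X * Y - Y * X \<in> classical_algebra t n"
  using assms
  by (cases t) (auto intro!: sl_algebra_bracket form_algebra_bracket simp: sym_form_def alt_form_def)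

lemma lie_moduleD:
  assumes "lie_module L M"
  shows "finite (indices M)"
    and "X \<in> L \<Longrightarrow> f \<in> vspace M \<Longrightarrow> action M X f \<in> vspace M"
    and "X \<in> L \<Longrightarrow> f \<in> vspace M \<Longrightarrow> g \<in> vspace M \<Longrightarrow>
      action M X (f + g) = action M X f + action M X g"
    and "X \<in> L \<Longrightarrow> f \<in> vspace M \<Longrightarrow> action M X (fscale c f) = fscale c (action M X f)"
    and "X \<in> L \<Longrightarrow> Y \<in> L \<Longrightarrow> f \<in> vspace M \<Longrightarrow>
      action M (X + Y) f = action M X f + action M Y f"
    and "X \<in> L \<Longrightarrow> f \<in> vspace M \<Longrightarrow> action M (c \<cdot>\<^sub>m X) f = fscale c (action M X f)"
    and "X \<in> L \<Longrightarrow> Y \<in> L \<Longrightarrow> f \<in> vspace M \<Longrightarrow>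
      action M (X * Y - Y * X) f = action M X (action M Y f) - action M Y (action M X f)"
  using assms by (simp_all add: lie_module_def)

lemma lie_module_pointwise:
  assumes "lie_module L M" and "X \<in> L" and "f \<in> vspace M"
  shows "g \<in> vspace M \<Longrightarrow> action M X (\<lambda>i. f i + g i) j = action M X f j + action M X g j"
    and "action M X (\<lambda>i. c * f i) j = c * action M X f j"
  using lie_moduleD(3)[OF assms(1-3), of g] lie_moduleD(4)[OF assms(1-3), of c]
  by (simp_all add: plus_fun_def fscale_def fun_eq_iff)

lemma tensor_power_pure:
  assumes M: "lie_module L M" and X: "X \<in> L" and w: "\<And>p. p < k \<Longrightarrow> w p \<in> vspace M"
  shows "action (tensor_power k M) X (pure_tensor k w) =
    (\<Sum>p<k. pure_tensor k (w(p := action M X (w p))))"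
proof
  fix l
  have sum_app: "(\<Sum>p<k. F p) l = (\<Sum>p<k. F p l)" for F :: "nat \<Rightarrow> 'a list \<Rightarrow> complex"
    by (induction k) auto
  show "action (tensor_power k M) X (pure_tensor k w) l =
    (\<Sum>p<k. pure_tensor k (w(p := action M X (w p)))) l"
  proof (cases "length l = k \<and> set l \<subseteq> indices M")
    case True
    have "action M X (\<lambda>i. pure_tensor k w (l[p := i])) (l ! p) =
        pure_tensor k (w(p := action M X (w p))) l" if p: "p < k" for p
    proof -
      let ?c = "\<Prod>q\<in>{..<k} - {p}. w q (l ! q)"
      have "(\<lambda>i. pure_tensor k w (l[p := i])) = fscale ?c (w p)"
        using True p
        by (auto simp: pure_tensor_def fscale_def fun_eq_iff prod.remove[of "{..<k}" p]
            intro!: prod.cong)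
      then have "action M X (\<lambda>i. pure_tensor k w (l[p := i])) = fscale ?c (action M X (w p))"
        using M X w[OF p] by (simp add: lie_module_def)
      moreover have "pure_tensor k (w(p := action M X (w p))) l = action M X (w p) (l ! p) * ?c"
        using True p by (auto simp: pure_tensor_def prod.remove[of "{..<k}" p] intro!: prod.cong)
      ultimately show ?thesis by (simp add: fscale_def)
    qed
    then show ?thesis using True unfolding sum_app by (simp add: tensor_power_def)
  next
    case False
    have "pure_tensor k (w(p := action M X (w p))) l = 0" if p: "p < k" for p
    proof (cases "length l = k")
      case True
      then obtain q where q: "q < k" "l ! q \<notin> indices M"
        using False by (metis in_set_conv_nth subsetI)
      have "action M X (w p) \<in> vspace M" using M X w[OF p] by (simp add: lie_module_def)
      then have "(w(p := action M X (w p))) q (l ! q) = 0"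
        using q w[OF q(1)] by (auto simp: vspace_def)
      then have "(\<Prod>q<k. (w(p := action M X (w p))) q (l ! q)) = 0"
        using q(1) by (intro prod_zero bexI[of _ q]) simp_all
      then show ?thesis by (simp add: pure_tensor_def)
    qed (auto simp: pure_tensor_def)
    then have "(\<Sum>p<k. pure_tensor k (w(p := action M X (w p))) l) = 0" by simp
    then show ?thesis using False unfolding sum_app by (auto simp: tensor_power_def)
  qed
qed

lemma lie_module_action_sum:
  assumes M: "lie_module L M" and X: "X \<in> L" and f: "f \<in> vspace M"
  shows "action M X f i = (\<Sum>j\<in>indices M. f j * action M X (unit_fun j) i)"
proof -
  have fin: "finite (indices M)" using M by (simp add: lie_module_def)
  have unit: "unit_fun j \<in> vspace M" if "j \<in> indices M" for j
    using that by (auto simp: vspace_def unit_fun_def)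
  have part: "(\<lambda>j. if j \<in> S then f j else 0) \<in> vspace M \<and>
      action M X (\<lambda>j. if j \<in> S then f j else 0) i = (\<Sum>j\<in>S. f j * action M X (unit_fun j) i)"
    if "finite S" "S \<subseteq> indices M" for S
    using that
  proof (induction S)
    case empty
    have z: "(\<lambda>j::'a. 0) \<in> vspace M" by (auto simp: vspace_def)
    have "action M X (fscale 0 (\<lambda>j. 0)) = fscale 0 (action M X (\<lambda>j. 0))"
      by (rule lie_moduleD(4)[OF M X z])
    then show ?case using z by (simp add: fscale_def zero_fun_def)
  next
    case (insert s S)
    have s: "s \<in> indices M" using insert by auto
    have eq: "(\<lambda>j. if j \<in> insert s S then f j else 0) =
        fscale (f s) (unit_fun s) + (\<lambda>j. if j \<in> S then f j else 0)"
      using insert by (auto simp: fun_eq_iff fscale_def unit_fun_def)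
    have u: "fscale (f s) (unit_fun s) \<in> vspace M"
      using unit[OF s] by (auto simp: vspace_def fscale_def)
    have "action M X (fscale (f s) (unit_fun s) + (\<lambda>j. if j \<in> S then f j else 0)) =
        fscale (f s) (action M X (unit_fun s)) + action M X (\<lambda>j. if j \<in> S then f j else 0)"
      using M X u insert unit[OF s] by (simp add: lie_module_def)
    then show ?case
      using insert unfolding eq by (auto simp: fscale_def vspace_def unit_fun_def)
  qed
  have "(\<lambda>j. if j \<in> indices M then f j else 0) = f"
    using f by (auto simp: vspace_def fun_eq_iff)
  then show ?thesis using part[OF fin subset_refl] by simp
qed

lemma dual_module_pairing:
  assumes M: "lie_module L M" and X: "X \<in> L" and v: "v \<in> vspace M"
  shows "(\<Sum>i\<in>indices M. action (dual_module M) X \<phi> i * v i) =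
    - (\<Sum>j\<in>indices M. \<phi> j * action M X v j)"
proof -
  have "(\<Sum>i\<in>indices M. action (dual_module M) X \<phi> i * v i) =
      - (\<Sum>i\<in>indices M. \<Sum>j\<in>indices M. \<phi> j * (v i * action M X (unit_fun i) j))"
    by (simp add: dual_module_def sum_negf sum_distrib_left mult_ac)
  also have "\<dots> =
      - (\<Sum>j\<in>indices M. \<Sum>i\<in>indices M. \<phi> j * (v i * action M X (unit_fun i) j))"
    by (subst sum.swap) (rule refl)
  finally show ?thesis by (simp add: lie_module_action_sum[OF M X v] sum_distrib_left)
qed

lemma lie_module_natural:
  assumes "L \<subseteq> carrier_mat N N"
  shows "lie_module L (natural_module N)"
proof -
  have br: "(\<Sum>j<N. (X * Y - Y * X) $$ (i, j) * f j) =
     (\<Sum>j<N. X $$ (i, j) * (if j < N then \<Sum>m<N. Y $$ (j, m) * f m else 0)) -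
     (\<Sum>j<N. Y $$ (i, j) * (if j < N then \<Sum>m<N. X $$ (j, m) * f m else 0))"
    if "X \<in> L" "Y \<in> L" "i < N" for X Y i f
  proof -
    have *: "(\<Sum>j<N. (Z * W) $$ (i, j) * f j) =
        (\<Sum>j<N. Z $$ (i, j) * (if j < N then \<Sum>m<N. W $$ (j, m) * f m else 0))"
      if "Z \<in> carrier_mat N N" "W \<in> carrier_mat N N" for Z W
    proof -
      have "(\<Sum>j<N. (Z * W) $$ (i, j) * f j) =
          (\<Sum>j<N. \<Sum>m<N. Z $$ (i, m) * (W $$ (m, j) * f j))"
        using that \<open>i < N\<close>
        by (intro sum.cong)
          (auto simp: scalar_prod_def atLeast0LessThan sum_distrib_right mult.assoc)
      also have "\<dots> = (\<Sum>m<N. \<Sum>j<N. Z $$ (i, m) * (W $$ (m, j) * f j))" by (rule sum.swap)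
      finally show ?thesis by (simp add: sum_distrib_left)
    qed
    have XY: "X \<in> carrier_mat N N" "Y \<in> carrier_mat N N" using that assms by auto
    have "(\<Sum>j<N. (X * Y - Y * X) $$ (i, j) * f j) =
        (\<Sum>j<N. (X * Y) $$ (i, j) * f j) - (\<Sum>j<N. (Y * X) $$ (i, j) * f j)"
      unfolding sum_subtractf[symmetric] using XY \<open>i < N\<close>
      by (intro sum.cong) (auto simp: algebra_simps)
    then show ?thesis using *[OF XY] *[OF XY(2) XY(1)] by simp
  qed
  have add: "(\<Sum>j<N. (X + Y) $$ (i, j) * f j) =
      (\<Sum>j<N. X $$ (i, j) * f j) + (\<Sum>j<N. Y $$ (i, j) * f j)"
    if "X \<in> L" "Y \<in> L" "i < N" for X Y i f
  proof -
    have XY: "X \<in> carrier_mat N N" "Y \<in> carrier_mat N N" using that assms by auto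
    show ?thesis unfolding sum.distrib[symmetric] using XY \<open>i < N\<close>
      by (intro sum.cong) (auto simp: algebra_simps)
  qed
  have scale: "(\<Sum>j<N. (c \<cdot>\<^sub>m X) $$ (i, j) * f j) = c * (\<Sum>j<N. X $$ (i, j) * f j)"
    if "X \<in> L" "i < N" for X i f c
  proof -
    have "X \<in> carrier_mat N N" using that assms by auto
    then show ?thesis unfolding sum_distrib_left using \<open>i < N\<close>
      by (intro sum.cong) auto
  qed
  show ?thesis
    unfolding lie_module_def natural_module_def
    by (auto simp: vspace_def fscale_def fun_eq_iff br add scale ring_distribs sum.distrib
        sum_distrib_left mult.left_commute)
qed

lemma lie_module_trivial: "lie_module L trivial_module"
  by (auto simp: lie_module_def trivial_module_def vspace_def fscale_def fun_eq_iff)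

lemma lie_module_dual:
  assumes M: "lie_module L M" and L: "\<And>X Y. X \<in> L \<Longrightarrow> Y \<in> L \<Longrightarrow> X * Y - Y * X \<in> L"
  shows "lie_module L (dual_module M)"
proof -
  have fin: "finite (indices M)" using M by (simp add: lie_module_def)
  have unit: "unit_fun j \<in> vspace M" if "j \<in> indices M" for j
    using that by (auto simp: vspace_def unit_fun_def)
  let ?I = "indices M" and ?a = "\<lambda>X i j. action M X (unit_fun i) j"
  have comp: "(\<Sum>j\<in>?I. (\<Sum>m\<in>?I. f m * ?a Y j m) * ?a X i j) =
      (\<Sum>m\<in>?I. f m * action M Y (action M X (unit_fun i)) m)"
    if "X \<in> L" "Y \<in> L" "i \<in> ?I" for X Y i f
  proof -
    have "action M X (unit_fun i) \<in> vspace M" using M that unit by (simp add: lie_module_def)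
    then have *: "action M Y (action M X (unit_fun i)) m = (\<Sum>j\<in>?I. ?a X i j * ?a Y j m)" for m
      using lie_module_action_sum[OF M] that by blast
    have "(\<Sum>j\<in>?I. (\<Sum>m\<in>?I. f m * ?a Y j m) * ?a X i j) =
        (\<Sum>j\<in>?I. \<Sum>m\<in>?I. f m * (?a X i j * ?a Y j m))"
      by (simp add: sum_distrib_left sum_distrib_right algebra_simps)
    also have "\<dots> = (\<Sum>m\<in>?I. \<Sum>j\<in>?I. f m * (?a X i j * ?a Y j m))" by (rule sum.swap)
    finally show ?thesis by (simp add: * sum_distrib_left)
  qed
  have br: "?a (X * Y - Y * X) i j =
      action M X (action M Y (unit_fun i)) j - action M Y (action M X (unit_fun i)) j"
    if "X \<in> L" "Y \<in> L" "i \<in> ?I" for X Y i j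
    using M that unit by (simp add: lie_module_def)
  have add: "?a (X + Y) i j = ?a X i j + ?a Y i j" if "X \<in> L" "Y \<in> L" "i \<in> ?I" for X Y i j
    using M that unit by (simp add: lie_module_def)
  have scale: "?a (c \<cdot>\<^sub>m X) i j = c * ?a X i j" if "X \<in> L" "i \<in> ?I" for X c i j
    using M that unit by (simp add: lie_module_def fscale_def)
  have dact: "action (dual_module M) X f i =
      (if i \<in> ?I then - (\<Sum>j\<in>?I. f j * ?a X i j) else 0)" for X f i
    by (simp add: dual_module_def)
  have dind: "indices (dual_module M) = ?I" by (simp add: dual_module_def)
  have two: "action (dual_module M) X (action (dual_module M) Y f) i =
      (\<Sum>m\<in>?I. f m * action M Y (action M X (unit_fun i)) m)"
    if "X \<in> L" "Y \<in> L" "i \<in> ?I" for X Y f i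
    using that by (simp add: dact sum_negf flip: comp)
  have "action (dual_module M) (X * Y - Y * X) f i =
      action (dual_module M) X (action (dual_module M) Y f) i -
      action (dual_module M) Y (action (dual_module M) X f) i"
    if XY: "X \<in> L" "Y \<in> L" for X Y f i
  proof (cases "i \<in> ?I")
    case True
    show ?thesis unfolding two[OF XY True] two[OF XY(2,1) True]
      using True by (simp add: dact br[OF XY True] algebra_simps sum_subtractf)
  qed (simp add: dact)
  then show ?thesis
    unfolding lie_module_def
    by (auto simp: fin dind dact vspace_def fscale_def fun_eq_iff add scale algebra_simps
        sum.distrib sum_distrib_left sum_negf)
qed

lemma lie_module_direct_sum:
  assumes M: "lie_module L M" and N: "lie_module L N"
  shows "lie_module L (direct_sum M N)"
proof -
  have l: "f \<circ> Inl \<in> vspace M" and r: "f \<circ> Inr \<in> vspace N"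
    if "f \<in> vspace (direct_sum M N)" for f
    using that by (auto simp: vspace_def direct_sum_def)
  have act: "action (direct_sum M N) X f =
      case_sum (action M X (f \<circ> Inl)) (action N X (f \<circ> Inr))" for X f
    by (simp add: direct_sum_def)
  have plus: "case_sum u v + case_sum u' v' = case_sum (u + u') (v + v')"
    and minus: "case_sum u v - case_sum u' v' = case_sum (u - u') (v - v')"
    and scale: "fscale c (case_sum u v) = case_sum (fscale c u) (fscale c v)"
    for u u' :: "'a \<Rightarrow> complex" and v v' :: "'b \<Rightarrow> complex" and c
    by (auto simp: fun_eq_iff fscale_def split: sum.split)
  have mem: "case_sum u v \<in> vspace (direct_sum M N)" if "u \<in> vspace M" "v \<in> vspace N" for u v
    using that by (auto simp: vspace_def direct_sum_def split: sum.split)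
  have fin: "finite (indices (direct_sum M N))"
    using M N by (simp add: lie_module_def direct_sum_def)
  have cs: "case_sum u v \<circ> Inl = u" "case_sum u v \<circ> Inr = v"
    for u :: "'a \<Rightarrow> complex" and v :: "'b \<Rightarrow> complex"
    by (auto simp: fun_eq_iff)
  have cL: "(f + g) \<circ> Inl = (f \<circ> Inl) + (g \<circ> Inl)" "fscale c f \<circ> Inl = fscale c (f \<circ> Inl)"
    "(f + g) \<circ> Inr = (f \<circ> Inr) + (g \<circ> Inr)" "fscale c f \<circ> Inr = fscale c (f \<circ> Inr)"
    for f g :: "'a + 'b \<Rightarrow> complex" and c
    by (auto simp: fun_eq_iff fscale_def)
  show ?thesis
    unfolding lie_module_def act
    by (intro conjI ballI allI fin)
      (simp_all add: mem l r plus minus scale cL cs lie_moduleD[OF M] lie_moduleD[OF N])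
qed

lemma lie_module_direct_power:
  assumes M: "lie_module L M"
  shows "lie_module L (direct_power a M)"
proof -
  have s: "(\<lambda>i. f (i, r)) \<in> vspace M" if "f \<in> vspace (direct_power a M)" for f r
    using that by (auto simp: vspace_def direct_power_def)
  have z: "action M X (\<lambda>i. 0) = (\<lambda>i. 0)" if "X \<in> L" for X
    using lie_module_action_sum[OF M that, of "\<lambda>i. 0"] by (auto simp: vspace_def)
  have act: "action (direct_power a M) X f (i, r) = action M X (\<lambda>i. f (i, r)) i" for X f i r
    by (simp add: direct_power_def)
  have fin: "finite (indices (direct_power a M))"
    using M by (simp add: lie_module_def direct_power_def)
  have cl: "action (direct_power a M) X f \<in> vspace (direct_power a M)"
    if X: "X \<in> L" and f: "f \<in> vspace (direct_power a M)" for X f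
  proof -
    have "action (direct_power a M) X f (i, r) = 0" if "(i, r) \<notin> indices (direct_power a M)" for i r
    proof (cases "r < a")
      case True
      then have "i \<notin> indices M" using that by (simp add: direct_power_def)
      moreover have "action M X (\<lambda>i. f (i, r)) \<in> vspace M"
        using M X s[OF f] by (simp add: lie_module_def)
      ultimately show ?thesis by (simp add: act vspace_def)
    next
      case False
      then have "(\<lambda>i. f (i, r)) = (\<lambda>i. 0)" using f by (auto simp: vspace_def direct_power_def)
      then show ?thesis using z[OF X] by (simp add: act)
    qed
    then show ?thesis by (auto simp: vspace_def)
  qed
  show ?thesis
    unfolding lie_module_def
    by (intro conjI ballI allI fin cl ext; simp add: split_paired_all)
      (simp_all add: act lie_module_pointwise[OF M] lie_moduleD[OF M] s fscale_def)
qed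

lemma lie_module_tensor_power:
  assumes M: "lie_module L M"
  shows "lie_module L (tensor_power k M)"
proof -
  let ?T = "tensor_power k M" and ?I = "indices M" and ?a = "\<lambda>X i j. action M X (unit_fun i) j"
  define good where "good l \<longleftrightarrow> length l = k \<and> set l \<subseteq> ?I" for l
  have ind: "l \<in> indices ?T \<longleftrightarrow> good l" for l by (simp add: tensor_power_def good_def)
  have act: "action ?T X t l =
      (if good l then \<Sum>p<k. action M X (\<lambda>i. t (l[p := i])) (l ! p) else 0)" for X t l
    by (simp add: tensor_power_def good_def)
  have fin: "finite (indices ?T)"
    using lie_moduleD(1)[OF M] finite_lists_length_eq[of ?I k]
    by (simp add: tensor_power_def conj_commute)
  have upd: "good (l[p := i])" if "good l" "i \<in> ?I" for l p i
    using that set_update_subset_insert[of l p i] by (auto simp: good_def)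
  have nth: "l ! p \<in> ?I" if "good l" "p < k" for l p
    using that by (auto simp: good_def)
  have sl: "(\<lambda>i. t (l[p := i])) \<in> vspace M" if "t \<in> vspace ?T" "good l" "p < k" for t l p
  proof -
    have "\<not> good (l[p := i])" if "i \<notin> ?I" for i
      using \<open>good l\<close> \<open>p < k\<close> that set_update_memI[of p l i] by (auto simp: good_def)
    then show ?thesis using \<open>t \<in> vspace ?T\<close> by (auto simp: vspace_def ind)
  qed
  have cl: "action ?T X t \<in> vspace ?T" for X t
    by (auto simp: vspace_def ind act)
  have br: "action ?T (X * Y - Y * X) t l =
      action ?T X (action ?T Y t) l - action ?T Y (action ?T X t) l"
    if X: "X \<in> L" and Y: "Y \<in> L" and t: "t \<in> vspace ?T" for X Y t l
  proof (cases "good l")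
    case l: True
    define D where "D X Y p q =
      (\<Sum>i\<in>?I. action M Y (\<lambda>j. t (l[p := i, q := j])) (l[p := i] ! q) * ?a X i (l ! p))" for X Y p q
    have two: "action ?T X (action ?T Y t) l = (\<Sum>p<k. \<Sum>q<k. D X Y p q)"
      if X: "X \<in> L" and Y: "Y \<in> L" for X Y
    proof -
      have "action M X (\<lambda>i. action ?T Y t (l[p := i])) (l ! p) = (\<Sum>q<k. D X Y p q)"
        if p: "p < k" for p
      proof -
        have "action M X (\<lambda>i. action ?T Y t (l[p := i])) (l ! p) =
            (\<Sum>i\<in>?I. action ?T Y t (l[p := i]) * ?a X i (l ! p))"
          by (rule lie_module_action_sum[OF M X sl[OF cl l p]])
        also have "\<dots> = (\<Sum>i\<in>?I. \<Sum>q<k.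
            action M Y (\<lambda>j. t (l[p := i, q := j])) (l[p := i] ! q) * ?a X i (l ! p))"
          by (intro sum.cong refl) (simp add: act upd[OF l] sum_distrib_right)
        also have "\<dots> = (\<Sum>q<k. D X Y p q)" unfolding D_def by (rule sum.swap)
        finally show ?thesis .
      qed
      then show ?thesis using l by (simp add: act[of X])
    qed
    have diag: "D X Y p p = action M X (action M Y (\<lambda>j. t (l[p := j]))) (l ! p)"
      if X: "X \<in> L" and Y: "Y \<in> L" and p: "p < k" for X Y p
      using lie_module_action_sum[OF M X lie_moduleD(2)[OF M Y sl[OF t l p]]] p l
      by (simp add: D_def good_def)
    have off: "D X Y p q = D Y X q p"
      if X: "X \<in> L" and Y: "Y \<in> L" and pq: "p < k" "q < k" "p \<noteq> q" for X Y p q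
    proof -
      have e: "D X Y p q =
          (\<Sum>i\<in>?I. \<Sum>j\<in>?I. t (l[p := i, q := j]) * ?a Y j (l ! q) * ?a X i (l ! p))"
        if X: "X \<in> L" and Y: "Y \<in> L" and pq: "p < k" "q < k" "p \<noteq> q" for X Y p q
        unfolding D_def
        by (intro sum.cong refl)
          (use pq in \<open>simp add: lie_module_action_sum[OF M Y sl[OF t upd[OF l]]] sum_distrib_right\<close>)
      show ?thesis
        unfolding e[OF X Y pq] e[OF Y X pq(2,1) pq(3)[symmetric]]
        by (subst sum.swap) (simp add: list_update_swap[OF pq(3)] ac_simps)
    qed
    have "action ?T X (action ?T Y t) l - action ?T Y (action ?T X t) l =
        (\<Sum>p<k. \<Sum>q<k. D X Y p q) - (\<Sum>p<k. \<Sum>q<k. D Y X q p)"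
      unfolding two[OF X Y] two[OF Y X] by (subst (2) sum.swap) simp
    also have "\<dots> = (\<Sum>p<k. \<Sum>q<k. D X Y p q - D Y X q p)"
      by (simp add: sum_subtractf)
    also have "\<dots> = (\<Sum>p<k. \<Sum>q<k. if p = q then D X Y p p - D Y X p p else 0)"
      by (intro sum.cong refl) (simp add: off[OF X Y])
    also have "\<dots> = (\<Sum>p<k. D X Y p p - D Y X p p)"
      by (simp add: sum.delta)
    also have "\<dots> = action ?T (X * Y - Y * X) t l"
      using l by (simp add: act diag[OF X Y] diag[OF Y X] lie_moduleD(7)[OF M X Y] sl[OF t])
    finally show ?thesis by simp
  qed (simp add: act)
  show ?thesis
    unfolding lie_module_def
    by (intro conjI ballI allI fin cl ext)
      (simp_all add: br, auto simp: act lie_module_pointwise[OF M] lie_moduleD[OF M] sl fscale_def sum.distrib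
        sum_distrib_left)
qed

lemma lie_module_classical:
  fixes t n
  defines "L \<equiv> classical_algebra t n" and "V \<equiv> natural_module (natural_dim t n)"
  shows "lie_module L (tensor_power k
    (direct_sum (direct_sum (direct_power a V) (direct_power b (dual_module V)))
      (direct_power c trivial_module)))"
  unfolding L_def V_def
  by (intro lie_module_tensor_power lie_module_direct_sum lie_module_direct_power lie_module_dual
      lie_module_natural lie_module_trivial classical_algebra_carrier classical_algebra_bracket)

end

theory Submission
  imports Defs
begin

text \<open>
  The standard Hermitian form on coordinates is contravariant, because each classical algebra is
  closed under conjugate transposition; orthogonal complements of submodules are therefore
  submodules.  Triangular decomposition shows that a simple submodule contains exactly one line of
  vectors killed by the strictly upper triangular elements (highest weight vectors).  Hence the
  length is the dimension of the space of highest weight vectors.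

  This dimension does not increase with \<open>n\<close> once \<open>n\<close> is large compared with \<open>k\<close>.  Embed the algebra
  of rank \<open>n\<close> into that of rank \<open>n + 1\<close> so that one basis vector in the middle of the natural module
  (type \<open>A\<close>), or a pair of basis vectors dual to each other (types \<open>B\<close>, \<open>C\<close>, \<open>D\<close>), is omitted.
  Forgetting the coordinates that involve an omitted index maps highest weight vectors to highest
  weight vectors, and it is injective on them: since \<open>n\<close> is large there are indices that do not
  occur in a given basis tensor, and strictly upper triangular matrix units joining these to the
  omitted indices express every forgotten coordinate through the remaining ones.  A sequence of
  natural numbers that is eventually non-increasing is eventually constant.
\<close>

section \<open>Dimension and orthogonal projection\<close>

lemma vspace_subset_span:
  assumes "finite (indices M)"
  shows "vspace M \<subseteq> fscale.span (unit_fun ` indices M)"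
proof
  fix f assume f: "f \<in> vspace M"
  have "f = (\<Sum>i\<in>indices M. fscale (f i) (unit_fun i))"
  proof
    fix j
    have "(\<Sum>i\<in>indices M. fscale (f i) (unit_fun i)) j =
        (\<Sum>i\<in>indices M. fscale (f i) (unit_fun i) j)"
      by (induction rule: infinite_finite_induct) auto
    also have "\<dots> = (\<Sum>i\<in>indices M. if j = i then f i else 0)"
      by (intro sum.cong) (auto simp: fscale_def unit_fun_def)
    also have "\<dots> = f j" using f assms by (auto simp: vspace_def)
    finally show "f j = (\<Sum>i\<in>indices M. fscale (f i) (unit_fun i)) j" by simp
  qed
  also have "\<dots> \<in> fscale.span (unit_fun ` indices M)"
    by (intro fscale.span_sum fscale.span_scale fscale.span_base) auto
  finally show "f \<in> fscale.span (unit_fun ` indices M)" .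
qed

lemma subspace_vspace: "fscale.subspace (vspace M)"
  by (auto simp: fscale.subspace_def vspace_def fscale_def)

text \<open>The ambient space of all functions may be infinite-dimensional. Finiteness of a basis of
  \<open>U\<close> comes from the unit functions, which form a finite set spanning
  \<open>vspace M\<close>; this makes \<open>fscale.dim\<close> meaningful on all subspaces
  considered here.\<close>

lemma fscale_basis:
  assumes "finite (indices M)" "U \<subseteq> vspace M"
  obtains B where "finite B" "B \<subseteq> U" "fscale.independent B" "U \<subseteq> fscale.span B"
    "card B = fscale.dim U"
proof -
  obtain B where B: "B \<subseteq> U" "fscale.independent B" "U \<subseteq> fscale.span B"
    "card B = fscale.dim U"
    by (rule fscale.basis_exists)
  have "B \<subseteq> fscale.span (unit_fun ` indices M)"
    using B(1) assms vspace_subset_span by blast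
  then have "finite B"
    using fscale.independent_span_bound[of "unit_fun ` indices M" B] B assms by auto
  then show ?thesis using that B by blast
qed

lemma card_le_fscale_dim:
  assumes "finite (indices M)" "U \<subseteq> vspace M" "fscale.independent A" "A \<subseteq> U"
  shows "finite A" "card A \<le> fscale.dim U"
proof -
  obtain B where B: "finite B" "B \<subseteq> U" "fscale.independent B" "U \<subseteq> fscale.span B"
    "card B = fscale.dim U"
    by (rule fscale_basis[OF assms(1,2)])
  have "A \<subseteq> fscale.span B" using assms(4) B(4) by (rule subset_trans)
  then show "finite A" "card A \<le> fscale.dim U"
    using fscale.independent_span_bound[OF B(1) assms(3)] B(5) by simp_all
qed

lemma fscale_dim_mono:
  assumes "finite (indices M)" "U \<subseteq> U'" "U' \<subseteq> vspace M"
  shows "fscale.dim U \<le> fscale.dim U'"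
proof -
  obtain B where "finite B" "B \<subseteq> U" "fscale.independent B" "U \<subseteq> fscale.span B"
    "card B = fscale.dim U"
    by (rule fscale_basis[OF assms(1) subset_trans[OF assms(2,3)]])
  then show ?thesis
    using card_le_fscale_dim(2)[OF assms(1,3), of B] subset_trans[OF _ assms(2)] by simp
qed

lemma fscale_dim_strict_mono:
  assumes "finite (indices M)" "U \<subset> U'" "U' \<subseteq> vspace M" "fscale.subspace U"
  shows "fscale.dim U < fscale.dim U'"
proof -
  have "U \<subseteq> vspace M" using assms(2,3) by blast
  then obtain B where B: "finite B" "B \<subseteq> U" "fscale.independent B" "U \<subseteq> fscale.span B"
    "card B = fscale.dim U"
    by (rule fscale_basis[OF assms(1)])
  obtain f where f: "f \<in> U'" "f \<notin> U" using assms by blast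
  have "fscale.span B \<subseteq> U" using B(2) assms(4) by (rule fscale.span_minimal)
  then have "f \<notin> fscale.span B" using f(2) by blast
  then have ind: "fscale.independent (insert f B)" using B(3) by (rule fscale.independent_insertI)
  have "insert f B \<subseteq> U'" using B(2) f(1) assms(2) by blast
  then have "card (insert f B) \<le> fscale.dim U'"
    by (rule card_le_fscale_dim(2)[OF assms(1,3) ind])
  moreover have "f \<notin> B" using f B by blast
  ultimately show ?thesis using B by simp
qed

section \<open>The Hermitian form and orthogonal projection\<close>

text \<open>The standard Hermitian form in coordinates. It sees only the coordinates in
  \<open>I\<close>, so it is definite only on functions vanishing outside \<open>I\<close>; this is
  why support conditions accompany it.\<close>

definition inner_on :: "'i set \<Rightarrow> ('i \<Rightarrow> complex) \<Rightarrow> ('i \<Rightarrow> complex) \<Rightarrow> complex" where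
  "inner_on I f g = (\<Sum>i\<in>I. f i * cnj (g i))"

lemma inner_on_linear:
  shows inner_on_add_left: "inner_on I (f + g) h = inner_on I f h + inner_on I g h"
    and inner_on_diff_left: "inner_on I (f - g) h = inner_on I f h - inner_on I g h"
    and inner_on_scale_left: "inner_on I (fscale c f) h = c * inner_on I f h"
    and inner_on_zero_left: "inner_on I 0 h = 0"
    and inner_on_add_right: "inner_on I h (f + g) = inner_on I h f + inner_on I h g"
    and inner_on_scale_right: "inner_on I h (fscale c f) = cnj c * inner_on I h f"
    and inner_on_zero_right: "inner_on I h 0 = 0"
  by (simp_all add: inner_on_def fscale_def algebra_simps sum.distrib sum_subtractf sum_distrib_left)

lemma inner_on_commute: "inner_on I g f = cnj (inner_on I f g)"
  by (simp add: inner_on_def mult.commute)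

lemma inner_on_self_eq_0:
  assumes "finite I" and "inner_on I f f = 0" and "i \<in> I"
  shows "f i = 0"
proof -
  have "inner_on I f f = of_real (\<Sum>i\<in>I. (cmod (f i))\<^sup>2)"
    unfolding inner_on_def of_real_sum by (intro sum.cong refl) (rule complex_norm_square[symmetric])
  then have "(\<Sum>i\<in>I. (cmod (f i))\<^sup>2) = 0" using assms(2) by (metis of_real_eq_0_iff)
  then show ?thesis using assms by (simp add: sum_nonneg_eq_0_iff)
qed

lemma inner_on_span_right:
  assumes "\<And>b. b \<in> B \<Longrightarrow> inner_on I f b = 0" and "g \<in> fscale.span B"
  shows "inner_on I f g = 0"
proof -
  have "fscale.subspace {g. inner_on I f g = 0}"
    by (simp add: fscale.subspace_def inner_on_linear)
  then have "fscale.span B \<subseteq> {g. inner_on I f g = 0}"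
    using assms(1) by (intro fscale.span_minimal) auto
  then show ?thesis using assms(2) by blast
qed

text \<open>Gram-Schmidt, one vector at a time: \<open>b\<close> is replaced by its component
  \<open>e\<close> orthogonal to \<open>span B\<close>, and the projection onto the line of
  \<open>e\<close> is added to the projection onto \<open>span B\<close>. If \<open>e\<close> has
  norm zero then the support condition gives \<open>e = 0\<close>, so \<open>b\<close> adds nothing
  to the span.\<close>

lemma orthogonal_projection_span:
  assumes "finite B" and "finite I" and "B \<subseteq> {f. \<forall>i. i \<notin> I \<longrightarrow> f i = 0}"
  shows "\<exists>u \<in> fscale.span B. \<forall>g \<in> fscale.span B. inner_on I (f - u) g = 0"
  using assms(1,3)
proof (induction B arbitrary: f)
  case empty
  show ?case by (simp add: inner_on_def)
next
  case (insert b B)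
  have out: "g i = 0" if "g \<in> fscale.span (insert b B)" "i \<notin> I" for g i
  proof -
    have "fscale.subspace {f. \<forall>i. i \<notin> I \<longrightarrow> f i = 0}"
      by (auto simp: fscale.subspace_def fscale_def)
    then show ?thesis using fscale.span_minimal[OF insert.prems] that by blast
  qed
  have sub: "fscale.span B \<subseteq> fscale.span (insert b B)"
    by (rule fscale.span_mono) auto
  have IH: "\<exists>u \<in> fscale.span B. \<forall>g \<in> fscale.span B. inner_on I (f - u) g = 0" for f
    using insert.prems by (intro insert.IH) blast
  obtain v where v: "v \<in> fscale.span B" "\<And>g. g \<in> fscale.span B \<Longrightarrow> inner_on I (b - v) g = 0"
    using IH[of b] by blast
  obtain u where u: "u \<in> fscale.span B" "\<And>g. g \<in> fscale.span B \<Longrightarrow> inner_on I (f - u) g = 0"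
    using IH[of f] by blast
  define e where "e = b - v"
  have e: "e \<in> fscale.span (insert b B)"
    unfolding e_def
    by (intro fscale.span_diff fscale.span_base insertI1 subsetD[OF sub v(1)])
  show ?case
  proof (cases "inner_on I e e = 0")
    case True
    then have "e i = 0" for i
      using inner_on_self_eq_0[OF assms(2) True] out[OF e] by (cases "i \<in> I") auto
    then have "b = v" by (auto simp: e_def fun_eq_iff)
    then have "fscale.span (insert b B) = fscale.span B"
      using v(1) fscale.span_redundant by blast
    then show ?thesis using u by metis
  next
    case False
    define c where "c = inner_on I (f - u) e / inner_on I e e"
    have eB: "inner_on I (f - (u + fscale c e)) g = 0" if "g \<in> fscale.span B" for g
      unfolding inner_on_linear e_def using u(2)[OF that] v(2)[OF that]
      by (simp only: inner_on_linear) simp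
    have "inner_on I (f - (u + fscale c e)) e = 0"
      unfolding inner_on_linear using False
      by (simp add: c_def field_simps inner_on_diff_left)
    then have "inner_on I (f - (u + fscale c e)) (e + v) = 0"
      using eB[OF v(1)] by (simp only: inner_on_add_right add_0_left)
    moreover have "e + v = b" unfolding e_def by (rule diff_add_cancel)
    ultimately have b: "inner_on I (f - (u + fscale c e)) b = 0" by (simp only:)
    have "inner_on I (f - (u + fscale c e)) g = 0" if g: "g \<in> fscale.span (insert b B)" for g
    proof (rule inner_on_span_right[OF _ g])
      fix x assume "x \<in> insert b B"
      then show "inner_on I (f - (u + fscale c e)) x = 0"
        using b eB[OF fscale.span_base] by (metis insertE)
    qed
    moreover have "u + fscale c e \<in> fscale.span (insert b B)"
      by (intro fscale.span_add fscale.span_scale e subsetD[OF sub u(1)])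
    ultimately show ?thesis by blast
  qed
qed

lemma orthogonal_projection:
  assumes fin: "finite (indices M)" and U: "fscale.subspace U" "U \<subseteq> vspace M"
  obtains u where "u \<in> U" "\<And>g. g \<in> U \<Longrightarrow> inner_on (indices M) (f - u) g = 0"
proof -
  obtain B where B: "finite B" "B \<subseteq> U" "fscale.independent B" "U \<subseteq> fscale.span B"
    "card B = fscale.dim U"
    by (rule fscale_basis[OF fin U(2)])
  have "fscale.span B = U" using fscale.span_minimal[OF B(2) U(1)] B(4) by (rule subset_antisym)
  moreover have "B \<subseteq> {f. \<forall>i. i \<notin> indices M \<longrightarrow> f i = 0}"
    using B(2) U(2) by (auto simp: vspace_def)
  ultimately show ?thesis
    using orthogonal_projection_span[OF B(1) fin, of f] that by auto
qed

section \<open>Length and highest weight vectors\<close>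

definition strictly_upper :: "complex mat \<Rightarrow> bool" where
  "strictly_upper X \<longleftrightarrow> (\<forall>i<dim_row X. \<forall>j<dim_col X. j \<le> i \<longrightarrow> X $$ (i, j) = 0)"

definition strictly_lower :: "complex mat \<Rightarrow> bool" where
  "strictly_lower X \<longleftrightarrow> (\<forall>i<dim_row X. \<forall>j<dim_col X. i \<le> j \<longrightarrow> X $$ (i, j) = 0)"

definition conj_transpose :: "complex mat \<Rightarrow> complex mat" where
  "conj_transpose X = mat (dim_col X) (dim_row X) (\<lambda>(i, j). cnj (X $$ (j, i)))"

text \<open>The invariants of the nilradical of the upper triangular Borel subalgebra. Its members
  need not be weight vectors, which makes it a subspace.\<close>

definition hw_space :: "complex mat set \<Rightarrow> 'i lie_mod \<Rightarrow> ('i \<Rightarrow> complex) set" where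
  "hw_space L M = {f \<in> vspace M. \<forall>X\<in>L. strictly_upper X \<longrightarrow> action M X f = 0}"

lemma strictly_upper_conj_transpose:
  "strictly_lower X \<Longrightarrow> strictly_upper (conj_transpose X)"
  by (auto simp: strictly_upper_def strictly_lower_def conj_transpose_def)

text \<open>Bracketing with a diagonal matrix rescales each entry separately. This is what lets
  diagonal elements of the algebra preserve the space of highest weight vectors.\<close>

lemma strictly_upper_diagonal_bracket:
  assumes D: "D \<in> carrier_mat N N" "diagonal_mat D" and X: "X \<in> carrier_mat N N" "strictly_upper X"
  shows "strictly_upper (X * D - D * X)"
proof -
  have "(X * D - D * X) $$ (i, j) = X $$ (i, j) * D $$ (j, j) - D $$ (i, i) * X $$ (i, j)"
    if "i < N" "j < N" for i j
  proof -
    have "(\<Sum>m<N. X $$ (i, m) * D $$ (m, j)) = (\<Sum>m<N. if m = j then X $$ (i, j) * D $$ (j, j) else 0)"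
      using D that by (intro sum.cong) (auto simp: diagonal_mat_def)
    moreover have "(\<Sum>m<N. D $$ (i, m) * X $$ (m, j)) = (\<Sum>m<N. if m = i then D $$ (i, i) * X $$ (i, j) else 0)"
      using D that by (intro sum.cong) (auto simp: diagonal_mat_def)
    ultimately show ?thesis
      using that D X by (simp add: scalar_prod_def atLeast0LessThan)
  qed
  then show ?thesis using X D by (auto simp: strictly_upper_def)
qed

lemma lie_module_action_zero:
  assumes "lie_module L M" "X \<in> L"
  shows "action M X 0 = 0"
  using lie_moduleD(4)[OF assms, of 0 0] by (auto simp: vspace_def fscale_def zero_fun_def)

lemma subspace_hw_space:
  assumes "lie_module L M"
  shows "fscale.subspace (hw_space L M)"
  unfolding fscale.subspace_def hw_space_def
  using fscale.subspace_add[OF subspace_vspace[of M]] fscale.subspace_scale[OF subspace_vspace[of M]]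
    fscale.subspace_0[OF subspace_vspace[of M]]
  by (auto simp: lie_module_action_zero[OF assms] lie_moduleD(3)[OF assms] lie_moduleD(4)[OF assms])

section \<open>Complete reducibility from a contravariant form\<close>

text \<open>Elementary substitutes for structure theory: \<open>triangular\<close> stands in for the
  root space decomposition, \<open>weights\<close> says that the basis consists of weight vectors,
  and \<open>grading\<close> replaces Engel's theorem for the strictly upper triangular
  elements.\<close>

locale unitary_module =
  fixes N :: nat and L :: "complex mat set" and M :: "'i lie_mod"
  assumes lie: "lie_module L M"
    and carrier: "L \<subseteq> carrier_mat N N"
    and bracket: "X \<in> L \<Longrightarrow> Y \<in> L \<Longrightarrow> X * Y - Y * X \<in> L"
    and add_closed: "X \<in> L \<Longrightarrow> Y \<in> L \<Longrightarrow> X + Y \<in> L"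
    and conj_transpose: "X \<in> L \<Longrightarrow> conj_transpose X \<in> L"
    and contravariant: "X \<in> L \<Longrightarrow> f \<in> vspace M \<Longrightarrow> g \<in> vspace M \<Longrightarrow>
      inner_on (indices M) (action M X f) g = inner_on (indices M) f (action M (conj_transpose X) g)"
    and triangular: "X \<in> L \<Longrightarrow> \<exists>Y D Z. Y \<in> L \<and> strictly_lower Y \<and> D \<in> L \<and> diagonal_mat D \<and>
      Z \<in> L \<and> strictly_upper Z \<and> X = Y + D + Z"
    and weights: "X \<in> L \<Longrightarrow> diagonal_mat X \<Longrightarrow>
      \<exists>w. \<forall>f\<in>vspace M. \<forall>i. action M X f i = w i * f i"
    and grading: "\<exists>\<phi> :: 'i \<Rightarrow> nat. \<forall>X\<in>L. strictly_upper X \<longrightarrow> (\<forall>f\<in>vspace M. \<forall>i.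
      action M X f i \<noteq> 0 \<longrightarrow> (\<exists>j. f j \<noteq> 0 \<and> \<phi> i < \<phi> j))"
begin

abbreviation "I \<equiv> indices M"
abbreviation "hw \<equiv> hw_space L M"

lemma fin: "finite I" using lie by (rule lie_moduleD)

lemmas action_zero = lie_module_action_zero[OF lie]

lemma action_diff:
  assumes "X \<in> L" "f \<in> vspace M" "g \<in> vspace M"
  shows "action M X (f - g) = action M X f - action M X g"
proof -
  have d: "f - g \<in> vspace M" using assms by (auto simp: vspace_def)
  have "action M X ((f - g) + g) = action M X (f - g) + action M X g"
    by (rule lie_moduleD(3)[OF lie assms(1) d assms(3)])
  then show ?thesis by (metis add_diff_cancel diff_add_cancel)
qed

lemma hw_subset: "hw \<subseteq> vspace M" by (auto simp: hw_space_def)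

lemmas subspace_hw = subspace_hw_space[OF lie]

definition orth_compl :: "('i \<Rightarrow> complex) set \<Rightarrow> ('i \<Rightarrow> complex) set \<Rightarrow> ('i \<Rightarrow> complex) set" where
  "orth_compl U W = {f \<in> U. \<forall>g\<in>W. inner_on I f g = 0}"

text \<open>The adjoint of \<open>action M X\<close> is the action of
  \<open>conj_transpose X\<close>, again an element of \<open>L\<close>, and \<open>W\<close> is
  stable under it.\<close>

lemma submodule_orth_compl:
  assumes U: "submodule L M U" and W: "submodule L M W"
  shows "submodule L M (orth_compl U W)"
  unfolding submodule_def
proof (intro conjI ballI)
  have "fscale.subspace U" using U by (simp add: submodule_def)
  then show "fscale.subspace (orth_compl U W)"
    by (auto simp: fscale.subspace_def orth_compl_def inner_on_linear)
  show "orth_compl U W \<subseteq> vspace M" using U by (auto simp: submodule_def orth_compl_def)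
  fix X f assume X: "X \<in> L" and f: "f \<in> orth_compl U W"
  have "inner_on I (action M X f) g = 0" if g: "g \<in> W" for g
  proof -
    have "f \<in> vspace M" "g \<in> vspace M" using f g U W by (auto simp: submodule_def orth_compl_def)
    then have "inner_on I (action M X f) g = inner_on I f (action M (conj_transpose X) g)"
      by (rule contravariant[OF X])
    also have "\<dots> = 0"
      using f g W conj_transpose[OF X] by (auto simp: submodule_def orth_compl_def)
    finally show ?thesis .
  qed
  then show "action M X f \<in> orth_compl U W" using f U X by (auto simp: orth_compl_def submodule_def)
qed

lemma self_orthogonal_zero:
  assumes "f \<in> vspace M" "inner_on I f f = 0" shows "f = 0"
proof
  fix i show "f i = 0 i"
    using inner_on_self_eq_0[OF fin assms(2)] assms(1) by (cases "i \<in> I") (auto simp: vspace_def)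
qed

lemma orthogonal_split:
  assumes U: "submodule L M U" and W: "submodule L M W" "W \<subseteq> U" and f: "f \<in> U"
  obtains u where "u \<in> W" "f - u \<in> orth_compl U W"
proof -
  obtain u where u: "u \<in> W" "\<And>g. g \<in> W \<Longrightarrow> inner_on I (f - u) g = 0"
    using orthogonal_projection[OF fin, of W f] W by (auto simp: submodule_def)
  have "f - u \<in> U"
    using U W u f fscale.subspace_diff[of U f u] by (auto simp: submodule_def)
  then show ?thesis using that u by (simp add: orth_compl_def)
qed

text \<open>Strictly upper triangular elements lower the maximal degree in the support of a vector, so
  they kill a nonzero vector for which this maximum is minimal.\<close>

lemma ex_hw_vector:
  assumes W: "submodule L M W" and ne: "W \<noteq> {0}"
  obtains f where "f \<in> W" "f \<in> hw" "f \<noteq> 0"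
proof -
  obtain \<phi> :: "'i \<Rightarrow> nat" where \<phi>: "\<And>X f i. X \<in> L \<Longrightarrow> strictly_upper X \<Longrightarrow> f \<in> vspace M \<Longrightarrow>
      action M X f i \<noteq> 0 \<Longrightarrow> \<exists>j. f j \<noteq> 0 \<and> \<phi> i < \<phi> j"
    using grading by blast
  have WV: "W \<subseteq> vspace M" and W0: "0 \<in> W"
    using W by (auto simp: submodule_def fscale.subspace_def)
  let ?P = "\<lambda>d. \<exists>f\<in>W. f \<noteq> 0 \<and> (\<forall>i. f i \<noteq> 0 \<longrightarrow> \<phi> i < d)"
  obtain f0 where f0: "f0 \<in> W" "f0 \<noteq> 0" using ne W0 by blast
  have "\<phi> i < Suc (Max (\<phi> ` I))" if "f0 i \<noteq> 0" for i
  proof -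
    have "i \<in> I" using that f0 WV by (auto simp: vspace_def)
    then show ?thesis using fin by (simp add: less_Suc_eq_le)
  qed
  then have "?P (Suc (Max (\<phi> ` I)))" using f0 by blast
  then have P: "?P (LEAST d. ?P d)" by (rule LeastI)
  define d where "d = (LEAST d. ?P d)"
  obtain f where f: "f \<in> W" "f \<noteq> 0" "\<And>i. f i \<noteq> 0 \<Longrightarrow> \<phi> i < d"
    using P unfolding d_def by blast
  obtain i0 where "f i0 \<noteq> 0" using f(2) by (auto simp: fun_eq_iff)
  then have d: "d > 0" using f(3) by fastforce
  have "action M X f = 0" if X: "X \<in> L" "strictly_upper X" for X
  proof (rule ccontr)
    assume ne: "action M X f \<noteq> 0"
    have "\<phi> i < d - 1" if "action M X f i \<noteq> 0" for i
      using \<phi>[OF X _ that] f(1) WV f(3) by fastforce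
    moreover have "action M X f \<in> W" using W X f by (auto simp: submodule_def)
    ultimately have "?P (d - 1)" using ne by blast
    then have "d \<le> d - 1" unfolding d_def by (rule Least_le)
    then show False using d by simp
  qed
  then show ?thesis using that f WV by (auto simp: hw_space_def)
qed

text \<open>The orthogonal complement of \<open>W\<close> in \<open>U\<close> is a nonzero
  submodule, so it contains a nonzero highest weight vector; such a vector in \<open>W\<close> would
  be orthogonal to itself. A strict chain of submodules therefore has strictly growing traces on
  \<open>hw\<close>, which bounds its length.\<close>

lemma hw_strict_mono:
  assumes U: "submodule L M U" and W: "submodule L M W" and "W \<subset> U"
  shows "W \<inter> hw \<subset> U \<inter> hw"
proof -
  obtain f where f: "f \<in> U" "f \<notin> W" using assms by blast
  obtain u where u: "u \<in> W" "f - u \<in> orth_compl U W"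
    using orthogonal_split[OF U W _ f(1)] assms by blast
  have "f - u \<noteq> 0" using f u by (metis eq_iff_diff_eq_0)
  then have "orth_compl U W \<noteq> {0}" using u by blast
  then obtain h where h: "h \<in> orth_compl U W" "h \<in> hw" "h \<noteq> 0"
    using ex_hw_vector[OF submodule_orth_compl[OF U W]] by blast
  have "h \<notin> W"
    using h self_orthogonal_zero[of h] U by (auto simp: orth_compl_def submodule_def)
  then show ?thesis using h assms by (auto simp: orth_compl_def)
qed

lemma chain_length_le:
  assumes F: "\<And>i. i \<le> m \<Longrightarrow> submodule L M (F i)" "\<And>i. i < m \<Longrightarrow> F i \<subset> F (Suc i)"
  shows "m \<le> fscale.dim hw"
proof -
  have "i \<le> fscale.dim (F i \<inter> hw)" if "i \<le> m" for i
    using that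
  proof (induction i)
    case (Suc i)
    have "fscale.dim (F i \<inter> hw) < fscale.dim (F (Suc i) \<inter> hw)"
    proof (rule fscale_dim_strict_mono[OF fin])
      show "F i \<inter> hw \<subset> F (Suc i) \<inter> hw"
        using Suc.prems F by (intro hw_strict_mono) auto
      show "F (Suc i) \<inter> hw \<subseteq> vspace M" using hw_subset by blast
      show "fscale.subspace (F i \<inter> hw)"
        using subspace_hw F(1)[of i] Suc.prems by (auto simp: submodule_def intro: fscale.subspace_inter)
    qed
    then show ?case using Suc by simp
  qed simp
  also have "fscale.dim (F m \<inter> hw) \<le> fscale.dim hw"
    by (rule fscale_dim_mono[OF fin _ hw_subset]) blast
  finally show ?thesis by simp
qed

section \<open>Submodules generated by a highest weight vector\<close>

text \<open>The space obtained from \<open>v\<close> by the enveloping algebra of the strictly lower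
  triangular part. Generating it inductively avoids constructing that algebra and gives induction
  over words in lowering elements.\<close>

inductive_set lower_span :: "('i \<Rightarrow> complex) \<Rightarrow> ('i \<Rightarrow> complex) set" for v where
  base: "v \<in> lower_span v"
| zero: "0 \<in> lower_span v"
| add: "f \<in> lower_span v \<Longrightarrow> g \<in> lower_span v \<Longrightarrow> f + g \<in> lower_span v"
| scale: "f \<in> lower_span v \<Longrightarrow> fscale c f \<in> lower_span v"
| lower: "f \<in> lower_span v \<Longrightarrow> Y \<in> L \<Longrightarrow> strictly_lower Y \<Longrightarrow> action M Y f \<in> lower_span v"

lemma lower_span_subset:
  assumes "submodule L M W" "v \<in> W" shows "lower_span v \<subseteq> W"
proof
  fix f assume "f \<in> lower_span v"
  then show "f \<in> W" using assms
    by induction (auto simp: submodule_def fscale.subspace_def)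
qed

lemma submodule_vspace: "submodule L M (vspace M)"
  using lie_moduleD(2)[OF lie] by (auto simp: submodule_def subspace_vspace)

text \<open>On \<open>v\<close> itself the triangular decomposition suffices: the upper part kills
  \<open>v\<close>, the diagonal part scales it. On \<open>Y f\<close> with \<open>Y\<close>
  lowering, \<open>X Y f = Y X f + [X, Y] f\<close>, and both terms are covered by the hypothesis on
  \<open>f\<close>, because it is stated for all elements of \<open>L\<close> at once.\<close>

lemma submodule_lower_span:
  assumes v: "v \<in> hw" and wt: "\<And>D. D \<in> L \<Longrightarrow> diagonal_mat D \<Longrightarrow> \<exists>c. action M D v = fscale c v"
  shows "submodule L M (lower_span v)"
proof -
  have sub: "lower_span v \<subseteq> vspace M"
    using v hw_subset by (intro lower_span_subset[OF submodule_vspace]) auto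
  have "\<forall>X\<in>L. action M X f \<in> lower_span v" if "f \<in> lower_span v" for f
    using that
  proof induction
    case base
    show ?case
    proof
      fix X assume "X \<in> L"
      then obtain Y D Z where YDZ: "Y \<in> L" "strictly_lower Y" "D \<in> L" "diagonal_mat D"
        "Z \<in> L" "strictly_upper Z" "X = Y + D + Z"
        using triangular by blast
      obtain c where c: "action M D v = fscale c v" using wt YDZ by blast
      have vV: "v \<in> vspace M" using v hw_subset by blast
      have "action M Z v = 0" using v YDZ by (simp add: hw_space_def)
      then have "action M X v = action M Y v + fscale c v"
        using YDZ vV add_closed[of Y D] c by (simp add: lie_moduleD(5)[OF lie])
      then show "action M X v \<in> lower_span v"
        using YDZ by (auto intro: lower_span.intros)
    qed
  next
    case zero
    show ?case using lower_span.zero action_zero by metis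
  next
    case (add f g)
    then show ?case
      using sub lie_moduleD(3)[OF lie] by (metis lower_span.add subsetD)
  next
    case (scale f c)
    then show ?case
      using sub lie_moduleD(4)[OF lie] by (metis lower_span.scale subsetD)
  next
    case (lower f Y)
    show ?case
    proof
      fix X assume X: "X \<in> L"
      have f: "f \<in> vspace M" using lower sub by blast
      have "action M X (action M Y f) = action M Y (action M X f) + action M (X * Y - Y * X) f"
        using lie_moduleD(7)[OF lie X \<open>Y \<in> L\<close> f] by (simp add: algebra_simps)
      also have "\<dots> \<in> lower_span v"
        using lower X bracket[OF X lower(2)] by (blast intro: lower_span.add lower_span.lower)
      finally show "action M X (action M Y f) \<in> lower_span v" .
    qed
  qed
  moreover have "fscale.subspace (lower_span v)"
    unfolding fscale.subspace_def by (blast intro: lower_span.zero lower_span.add lower_span.scale)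
  ultimately show ?thesis using sub unfolding submodule_def by blast
qed


text \<open>Take a nonzero highest weight vector \<open>v\<close> in \<open>W\<close> of minimal
  support. A diagonal \<open>D\<close> multiplies coordinate \<open>i\<close> by \<open>w i\<close>,
  so \<open>D v - w i0 v\<close> is again a highest weight vector in \<open>W\<close>, but its
  support loses \<open>i0\<close>; by minimality it is zero. One choice of \<open>v\<close> serves
  all \<open>D\<close>, so no simultaneous diagonalization is required.\<close>

lemma ex_weight_vector:
  assumes W: "submodule L M W" and ne: "W \<noteq> {0}"
  obtains v where "v \<in> W" "v \<in> hw" "v \<noteq> 0"
    "\<And>D. D \<in> L \<Longrightarrow> diagonal_mat D \<Longrightarrow> \<exists>c. action M D v = fscale c v"
proof -
  have WV: "W \<subseteq> vspace M" using W by (simp add: submodule_def)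
  define Q where "Q f \<longleftrightarrow> f \<in> W \<and> f \<in> hw \<and> f \<noteq> 0" for f
  obtain f0 where "Q f0" using ex_hw_vector[OF W ne] unfolding Q_def by blast
  then obtain v where v: "Q v" and min: "\<And>f. Q f \<Longrightarrow> card {i. v i \<noteq> 0} \<le> card {i. f i \<noteq> 0}"
    using ex_has_least_nat[of Q f0 "\<lambda>f. card {i. f i \<noteq> 0}"] by blast
  have vW: "v \<in> W" "v \<in> hw" "v \<noteq> 0" and vV: "v \<in> vspace M" using v WV by (auto simp: Q_def)
  have finv: "finite {i. v i \<noteq> 0}"
    using vV by (intro finite_subset[OF _ fin]) (auto simp: vspace_def)
  obtain i0 where i0: "v i0 \<noteq> 0" using vW(3) by (auto simp: fun_eq_iff)
  have "\<exists>c. action M D v = fscale c v" if D: "D \<in> L" "diagonal_mat D" for D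
  proof -
    obtain w where w: "\<And>f i. f \<in> vspace M \<Longrightarrow> action M D f i = w i * f i"
      using weights[OF D] by blast
    define g where "g = action M D v - fscale (w i0) v"
    have gW: "g \<in> W" unfolding g_def
      using W vW D by (intro fscale.subspace_diff fscale.subspace_scale) (auto simp: submodule_def)
    have DV: "action M D v \<in> vspace M" using lie_moduleD(2)[OF lie D(1) vV] .
    have "action M X (action M D v) = 0" if X: "X \<in> L" "strictly_upper X" for X
    proof -
      have "strictly_upper (X * D - D * X)"
        using carrier D X by (intro strictly_upper_diagonal_bracket[of _ N]) auto
      then have "action M (X * D - D * X) v = 0"
        using vW(2) bracket X D by (simp add: hw_space_def)
      moreover have "action M X v = 0" using vW(2) X by (simp add: hw_space_def)
      ultimately show ?thesis
        using lie_moduleD(7)[OF lie X(1) D(1) vV] action_zero[OF D(1)] by simp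
    qed
    then have "action M D v \<in> hw" using DV by (simp add: hw_space_def)
    then have ghw: "g \<in> hw" unfolding g_def
      using subspace_hw vW by (intro fscale.subspace_diff fscale.subspace_scale) auto
    have gi: "g i = (w i - w i0) * v i" for i
      by (simp add: g_def w[OF vV] fscale_def algebra_simps)
    have "{i. g i \<noteq> 0} \<subset> {i. v i \<noteq> 0}" using i0 by (auto simp: gi)
    then have "card {i. g i \<noteq> 0} < card {i. v i \<noteq> 0}" by (rule psubset_card_mono[OF finv])
    then have "\<not> Q g" using min[of g] by linarith
    then have "g = 0" using gW ghw by (simp add: Q_def)
    then have "action M D v = fscale (w i0) v" by (simp add: g_def)
    then show ?thesis by blast
  qed
  then show ?thesis using that vW by blast
qed

text \<open>A simple submodule is spanned by a weight vector \<open>v\<close> among its highest weight vectors together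
  with the images of strictly lower triangular elements, and by contravariance these images are
  orthogonal to every highest weight vector.\<close>

lemma dim_hw_simple:
  assumes W: "submodule L M W" and simple: "\<And>S. submodule L M S \<Longrightarrow> S \<subseteq> W \<Longrightarrow> S = {0} \<or> S = W"
  obtains v where "W \<inter> hw \<subseteq> fscale.span {v}"
proof (cases "W = {0}")
  case True
  then show ?thesis using that[of 0] fscale.span_zero[of "{0}"] by blast
next
  case False
  obtain v where v: "v \<in> W" "v \<in> hw" "v \<noteq> 0"
    "\<And>D. D \<in> L \<Longrightarrow> diagonal_mat D \<Longrightarrow> \<exists>c. action M D v = fscale c v"
    using ex_weight_vector[OF W False] by metis
  have vV: "v \<in> vspace M" using v hw_subset by blast
  have "submodule L M (lower_span v)" by (rule submodule_lower_span[OF v(2,4)])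
  then have S: "lower_span v = W"
    using simple[of "lower_span v"] lower_span_subset[OF W v(1)] lower_span.base[of v] v(3) by blast
  have orth: "inner_on I f g = 0" if f: "f \<in> hw" "inner_on I f v = 0" and g: "g \<in> lower_span v" for f g
    using g
  proof induction
    case (lower g Y)
    have gV: "g \<in> vspace M" using lower S W by (auto simp: submodule_def)
    have fV: "f \<in> vspace M" using f hw_subset by blast
    have "inner_on I (action M Y g) f = inner_on I g (action M (conj_transpose Y) f)"
      by (rule contravariant[OF lower(2) gV fV])
    also have "action M (conj_transpose Y) f = 0"
      using f(1) lower strictly_upper_conj_transpose conj_transpose by (simp add: hw_space_def)
    finally show ?case
      using inner_on_commute[of I f "action M Y g"] by (simp only: inner_on_linear complex_cnj_zero)
  qed (simp_all only: f inner_on_linear mult_zero_right add_0_left)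
  have vv: "inner_on I v v \<noteq> 0" using self_orthogonal_zero[OF vV] v(3) by blast
  have "W \<inter> hw \<subseteq> fscale.span {v}"
  proof
    fix f assume f: "f \<in> W \<inter> hw"
    define c where "c = inner_on I f v / inner_on I v v"
    define g where "g = f - fscale c v"
    have "g \<in> W" unfolding g_def
      using W f v by (intro fscale.subspace_diff fscale.subspace_scale) (auto simp: submodule_def)
    moreover have "g \<in> hw" unfolding g_def
      using subspace_hw f v by (intro fscale.subspace_diff fscale.subspace_scale) auto
    moreover have "inner_on I g v = 0"
      unfolding g_def inner_on_diff_left inner_on_scale_left c_def using vv by simp
    \<comment> \<open>\<open>g\<close> lies both in \<open>hw\<close> and in
      \<open>W = lower_span v\<close>, so \<open>orth\<close> applies with \<open>g\<close> in both
      arguments.\<close>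
    ultimately have "inner_on I g g = 0" using orth S by blast
    then have "g = 0" using \<open>g \<in> hw\<close> hw_subset by (intro self_orthogonal_zero) auto
    then have "f = fscale c v" by (simp add: g_def)
    then show "f \<in> fscale.span {v}" by (simp add: fscale.span_scale fscale.span_base)
  qed
  then show ?thesis by (rule that)
qed

section \<open>Chains of submodules and the length formula\<close>

lemma ex_simple_submodule:
  assumes U: "submodule L M U" "U \<noteq> {0}"
  obtains W where "submodule L M W" "W \<subseteq> U" "W \<noteq> {0}"
    "\<And>S. submodule L M S \<Longrightarrow> S \<subseteq> W \<Longrightarrow> S = {0} \<or> S = W"
proof -
  define Q where "Q W \<longleftrightarrow> submodule L M W \<and> W \<subseteq> U \<and> W \<noteq> {0}" for W
  have "Q U" using U by (simp add: Q_def)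
  then obtain W where W: "Q W" and min: "\<And>S. Q S \<Longrightarrow> fscale.dim W \<le> fscale.dim S"
    using ex_has_least_nat[of Q U fscale.dim] by blast
  have "S = {0} \<or> S = W" if S: "submodule L M S" "S \<subseteq> W" for S
  proof (rule ccontr)
    assume *: "\<not> ?thesis"
    then have "fscale.dim S < fscale.dim W"
      using S W by (intro fscale_dim_strict_mono[OF fin]) (auto simp: Q_def submodule_def)
    moreover have "Q S" using * S W by (auto simp: Q_def)
    ultimately show False using min[of S] by linarith
  qed
  then show ?thesis using W that by (auto simp: Q_def)
qed

text \<open>Split off a simple submodule \<open>W\<close>, take a chain for its complement
  \<open>U1\<close> in \<open>U\<close>, and add \<open>U\<close> on top. The highest weight vectors
  of \<open>U\<close> are spanned by those of \<open>U1\<close> together with one vector from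
  \<open>W\<close>, so one more step of the chain pays for the growth of the dimension.\<close>

lemma ex_chain:
  assumes "submodule L M U"
  shows "\<exists>m F. fscale.dim (U \<inter> hw) \<le> m \<and> (\<forall>i\<le>m. submodule L M (F i)) \<and>
    (\<forall>i<m. F i \<subset> F (Suc i)) \<and> F m = U"
  using assms
proof (induction "fscale.dim U" arbitrary: U rule: less_induct)
  case less
  show ?case
  proof (cases "U = {0}")
    case True
    have "fscale.dim (U \<inter> hw) \<le> card ({} :: ('i \<Rightarrow> complex) set)"
      using True by (intro fscale.dim_le_card) auto
    then show ?thesis using less.prems by (intro exI[of _ 0] exI[of _ "\<lambda>_. U"]) auto
  next
    case False
    obtain W where W: "submodule L M W" "W \<subseteq> U" "W \<noteq> {0}"
      "\<And>S. submodule L M S \<Longrightarrow> S \<subseteq> W \<Longrightarrow> S = {0} \<or> S = W"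
      using ex_simple_submodule[OF less.prems False] by metis
    obtain v where v: "W \<inter> hw \<subseteq> fscale.span {v}"
      using dim_hw_simple[OF W(1,4)] by metis
    define U1 where "U1 = orth_compl U W"
    have U1: "submodule L M U1" unfolding U1_def by (rule submodule_orth_compl[OF less.prems W(1)])
    have "0 \<in> W" using W(1) by (simp add: submodule_def fscale.subspace_def)
    then obtain w where w: "w \<in> W" "w \<noteq> 0" using W(3) by blast
    have disj: "f = 0" if "f \<in> U1" "f \<in> W" for f
      using that W(1) self_orthogonal_zero[of f] by (auto simp: U1_def orth_compl_def submodule_def)
    have "w \<notin> U1" using disj w by blast
    then have sub: "U1 \<subset> U" using w W(2) by (auto simp: U1_def orth_compl_def)
    have UV: "U \<subseteq> vspace M" using less.prems by (simp add: submodule_def)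
    have "fscale.dim U1 < fscale.dim U"
      using U1 sub UV by (intro fscale_dim_strict_mono[OF fin]) (auto simp: submodule_def)
    then obtain m F where F: "fscale.dim (U1 \<inter> hw) \<le> m" "\<forall>i\<le>m. submodule L M (F i)"
      "\<forall>i<m. F i \<subset> F (Suc i)" "F m = U1"
      using less.hyps U1 by blast
    have "U1 \<inter> hw \<subseteq> vspace M" using hw_subset by blast
    then obtain B where B: "finite B" "B \<subseteq> U1 \<inter> hw" "fscale.independent B"
      "U1 \<inter> hw \<subseteq> fscale.span B" "card B = fscale.dim (U1 \<inter> hw)"
      by (rule fscale_basis[OF fin])
    have "U \<inter> hw \<subseteq> fscale.span (insert v B)"
    proof
      fix f assume f: "f \<in> U \<inter> hw"
      then have "f \<in> U" by blast
      then obtain u where u: "u \<in> W" "f - u \<in> U1"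
        unfolding U1_def by (rule orthogonal_split[OF less.prems W(1,2)])
      have fV: "f \<in> vspace M" and uV: "u \<in> vspace M" using f u UV W(2) by auto
      \<comment> \<open>The two components of a highest weight vector are highest weight vectors:
        \<open>X u\<close> lies in \<open>W\<close>, and \<open>X (f - u) = - X u\<close> lies in
        \<open>U1\<close>, so \<open>X u\<close> lies in both.\<close>
      have "action M X u = 0" if X: "X \<in> L" "strictly_upper X" for X
      proof (rule disj)
        show Xu: "action M X u \<in> W" using u(1) W(1) X by (simp add: submodule_def)
        have "action M X (f - u) = action M X f - action M X u"
          by (rule action_diff[OF X(1) fV uV])
        also have "\<dots> = - action M X u" using f X by (simp add: hw_space_def)
        moreover have "action M X (f - u) \<in> U1" using u(2) U1 X by (auto simp only: submodule_def)
        ultimately have "- action M X u \<in> U1" by (simp only:)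
        then have "- (- action M X u) \<in> U1"
          using U1 fscale.subspace_neg by (auto simp only: submodule_def)
        then show "action M X u \<in> U1" by (simp only: minus_minus)
      qed
      then have uhw: "u \<in> hw" using uV by (simp add: hw_space_def)
      then have "f - u \<in> hw" using f subspace_hw by (intro fscale.subspace_diff) auto
      then have "f - u \<in> fscale.span (insert v B)"
        using u(2) B(4) fscale.span_mono[of B "insert v B"] by blast
      moreover have "u \<in> fscale.span (insert v B)"
        using u(1) uhw v fscale.span_mono[of "{v}" "insert v B"] by blast
      ultimately have "(f - u) + u \<in> fscale.span (insert v B)" by (rule fscale.span_add)
      then show "f \<in> fscale.span (insert v B)" by (simp only: diff_add_cancel)
    qed
    then have "fscale.dim (U \<inter> hw) \<le> card (insert v B)"
      using B(1) by (intro fscale.dim_le_card) auto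
    also have "\<dots> \<le> Suc m" using B(1,5) F(1) card_insert_le_m1[of "Suc m" B v] by simp
    finally have "fscale.dim (U \<inter> hw) \<le> Suc m" .
    moreover have "submodule L M ((F(Suc m := U)) i)" if "i \<le> Suc m" for i
      using that F(2) less.prems by (auto simp: le_Suc_eq)
    moreover have "(F(Suc m := U)) i \<subset> (F(Suc m := U)) (Suc i)" if "i < Suc m" for i
      using that F(3,4) sub by (auto simp: less_Suc_eq)
    ultimately show ?thesis by (intro exI[of _ "Suc m"] exI[of _ "F(Suc m := U)"]) auto
  qed
qed

theorem module_length_eq_dim_hw: "module_length L M = enat (fscale.dim hw)"
proof (rule antisym)
  show "module_length L M \<le> enat (fscale.dim hw)"
    unfolding module_length_def using chain_length_le by (intro SUP_least) auto
  obtain m F where F: "fscale.dim (vspace M \<inter> hw) \<le> m" "\<forall>i\<le>m. submodule L M (F i)"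
    "\<forall>i<m. F i \<subset> F (Suc i)"
    using ex_chain[OF submodule_vspace] by blast
  have "vspace M \<inter> hw = hw" using hw_subset by blast
  then have "enat (fscale.dim hw) \<le> enat m" using F(1) by simp
  also have "\<dots> \<le> module_length L M"
    unfolding module_length_def using F(2,3) by (intro SUP_upper) auto
  finally show "enat (fscale.dim hw) \<le> module_length L M" .
qed

end

section \<open>Mixed tensor powers\<close>

type_synonym mixed_index = "((nat \<times> nat) + (nat \<times> nat)) + (unit \<times> nat)"

definition mixed_module :: "nat \<Rightarrow> nat \<Rightarrow> nat \<Rightarrow> nat \<Rightarrow> mixed_index lie_mod" where
  "mixed_module a b c N = direct_sum
    (direct_sum (direct_power a (natural_module N)) (direct_power b (dual_module (natural_module N))))
    (direct_power c trivial_module)"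

section \<open>Coordinates for the action on mixed tensors\<close>

text \<open>The matrix of \<open>X\<close> in the basis of the mixed module, with row
  \<open>y\<close> and column \<open>z\<close>: copies of \<open>X\<close> on the natural summands,
  of minus its transpose on the dual ones, and zero on the trivial ones.\<close>

fun coef :: "complex mat \<Rightarrow> mixed_index \<Rightarrow> mixed_index \<Rightarrow> complex" where
  "coef X (Inl (Inl (i, r))) (Inl (Inl (j, s))) = (if r = s then X $$ (i, j) else 0)"
| "coef X (Inl (Inr (i, r))) (Inl (Inr (j, s))) = (if r = s then - X $$ (j, i) else 0)"
| "coef X _ _ = 0"

lemma indices_mixed_module:
  "indices (mixed_module a b c N) = (({..<N} \<times> {..<a}) <+> ({..<N} \<times> {..<b})) <+> (UNIV \<times> {..<c})"
  by (simp add: mixed_module_def direct_sum_def direct_power_def natural_module_def dual_module_def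
      trivial_module_def)

lemma finite_indices_mixed_module: "finite (indices (mixed_module a b c N))"
  by (simp add: indices_mixed_module)

lemma mixed_index_cases:
  assumes "y \<in> indices (mixed_module a b c N)"
  obtains i r where "y = Inl (Inl (i, r))" "i < N" "r < a"
  | i r where "y = Inl (Inr (i, r))" "i < N" "r < b"
  | r where "y = Inr ((), r)" "r < c"
  using assms by (auto simp: indices_mixed_module)

lemma coef_nonzero_cases:
  assumes "coef X y z \<noteq> 0"
  obtains i j r where "y = Inl (Inl (i, r))" "z = Inl (Inl (j, r))" "X $$ (i, j) \<noteq> 0"
  | i j r where "y = Inl (Inr (i, r))" "z = Inl (Inr (j, r))" "X $$ (j, i) \<noteq> 0"
  using assms by (cases "(X, y, z)" rule: coef.cases) (auto split: if_splits)

lemma sum_coef: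
  shows "r < a \<Longrightarrow> (\<Sum>z\<in>indices (mixed_module a b c N). coef X (Inl (Inl (i, r))) z * g z) =
      (\<Sum>j<N. X $$ (i, j) * g (Inl (Inl (j, r))))"
    and "r < b \<Longrightarrow> (\<Sum>z\<in>indices (mixed_module a b c N). coef X (Inl (Inr (i, r))) z * g z) =
      - (\<Sum>j<N. X $$ (j, i) * g (Inl (Inr (j, r))))"
    and "(\<Sum>z\<in>indices (mixed_module a b c N). coef X (Inr u) z * g z) = 0"
proof -
  have dist: "(\<Sum>x\<in>{..<N} \<times> {..<m}. (case x of (j, s) \<Rightarrow> if r = s then h j else 0) * g' x) =
      (\<Sum>j<N. h j * g' (j, r))" if "r < m" for m h and g' :: "nat \<times> nat \<Rightarrow> complex"
  proof -
    have "(\<Sum>x\<in>{..<N} \<times> {..<m}. (case x of (j, s) \<Rightarrow> if r = s then h j else 0) * g' x) =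
        (\<Sum>j<N. \<Sum>s<m. if r = s then h j * g' (j, r) else 0)"
      unfolding sum.cartesian_product by (intro sum.cong) auto
    then show ?thesis using that by simp
  qed
  have L: "coef X (Inl (Inl (i, r))) (Inl (Inl x)) = (case x of (j, s) \<Rightarrow> if r = s then X $$ (i, j) else 0)"
    and R: "coef X (Inl (Inr (i, r))) (Inl (Inr x)) = (case x of (j, s) \<Rightarrow> if r = s then - X $$ (j, i) else 0)"
    for x by (auto split: prod.split)
  show "r < a \<Longrightarrow> (\<Sum>z\<in>indices (mixed_module a b c N). coef X (Inl (Inl (i, r))) z * g z) =
      (\<Sum>j<N. X $$ (i, j) * g (Inl (Inl (j, r))))"
    unfolding indices_mixed_module by (simp add: sum.Plus L dist)
  show "r < b \<Longrightarrow> (\<Sum>z\<in>indices (mixed_module a b c N). coef X (Inl (Inr (i, r))) z * g z) =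
      - (\<Sum>j<N. X $$ (j, i) * g (Inl (Inr (j, r))))"
    unfolding indices_mixed_module by (simp add: sum.Plus R dist sum_negf)
  show "(\<Sum>z\<in>indices (mixed_module a b c N). coef X (Inr u) z * g z) = 0"
    by simp
qed

lemma action_mixed_module:
  assumes "y \<in> indices (mixed_module a b c N)"
  shows "action (mixed_module a b c N) X f y = (\<Sum>z\<in>indices (mixed_module a b c N). coef X y z * f z)"
proof -
  have u: "(\<Sum>m<N. X $$ (j, m) * unit_fun i m) = X $$ (j, i)" if "i < N" for i j
  proof -
    have "(\<Sum>m<N. X $$ (j, m) * unit_fun i m) = (\<Sum>m<N. if m = i then X $$ (j, i) else 0)"
      by (intro sum.cong) (auto simp: unit_fun_def)
    then show ?thesis using that by simp
  qed
  show ?thesis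
    using assms
  proof (cases rule: mixed_index_cases)
    case (1 i r)
    then show ?thesis
      by (simp add: sum_coef) (simp add: mixed_module_def direct_sum_def direct_power_def natural_module_def)
  next
    case (2 i r)
    then show ?thesis
      by (simp add: sum_coef)
        (simp add: mixed_module_def direct_sum_def direct_power_def natural_module_def dual_module_def u,
          simp add: mult.commute)
  next
    case (3 r)
    then show ?thesis
      by (simp add: sum_coef)
        (simp add: mixed_module_def direct_sum_def direct_power_def trivial_module_def)
  qed
qed

lemma indices_tensor_power: "l \<in> indices (tensor_power k M) \<longleftrightarrow> length l = k \<and> set l \<subseteq> indices M"
  by (simp add: tensor_power_def)

lemma tensor_index_nth: "l \<in> indices (tensor_power k M) \<Longrightarrow> p < k \<Longrightarrow> l ! p \<in> indices M"
  by (auto simp: tensor_power_def)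

lemma tensor_index_update:
  "l \<in> indices (tensor_power k M) \<Longrightarrow> z \<in> indices M \<Longrightarrow> l[p := z] \<in> indices (tensor_power k M)"
  using set_update_subset_insert[of l p z] by (auto simp: tensor_power_def)

text \<open>The Leibniz rule in coordinates. Everything proved below about the action on tensors is
  read off from this formula.\<close>

lemma action_tensor_mixed:
  assumes "l \<in> indices (tensor_power k (mixed_module a b c N))"
  shows "action (tensor_power k (mixed_module a b c N)) X t l =
    (\<Sum>p<k. \<Sum>z\<in>indices (mixed_module a b c N). coef X (l ! p) z * t (l[p := z]))"
proof -
  have "action (mixed_module a b c N) X (\<lambda>i. t (l[p := i])) (l ! p) =
      (\<Sum>z\<in>indices (mixed_module a b c N). coef X (l ! p) z * t (l[p := z]))" if "p < k" for p
    by (rule action_mixed_module[OF tensor_index_nth[OF assms that]])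
  then show ?thesis using assms by (simp add: tensor_power_def)
qed

lemma coef_conj_transpose:
  assumes "X \<in> carrier_mat N N" and "y \<in> indices (mixed_module a b c N)" "z \<in> indices (mixed_module a b c N)"
  shows "coef (conj_transpose X) y z = cnj (coef X z y)"
  using assms(2,3) assms(1)
  by (elim mixed_index_cases) (auto simp: conj_transpose_def)

lemma contravariant_tensor_mixed:
  fixes a b c N k
  defines "M \<equiv> mixed_module a b c N"
  assumes X: "X \<in> carrier_mat N N"
  shows "inner_on (indices (tensor_power k M)) (action (tensor_power k M) X f) g =
    inner_on (indices (tensor_power k M)) f (action (tensor_power k M) (conj_transpose X) g)"
proof -
  let ?T = "indices (tensor_power k M)" and ?I = "indices M"
  have "inner_on ?T (action (tensor_power k M) X f) g =
      (\<Sum>l\<in>?T. \<Sum>p<k. \<Sum>z\<in>?I. coef X (l ! p) z * f (l[p := z]) * cnj (g l))"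
    unfolding inner_on_def M_def
    by (intro sum.cong) (auto simp: action_tensor_mixed sum_distrib_right)
  also have "\<dots> = (\<Sum>p<k. \<Sum>(l, z)\<in>?T \<times> ?I. coef X (l ! p) z * f (l[p := z]) * cnj (g l))"
    by (subst sum.swap) (simp add: sum.cartesian_product)
  also have "\<dots> = (\<Sum>p<k. \<Sum>(l, z)\<in>?T \<times> ?I. f l * (coef X z (l ! p) * cnj (g (l[p := z]))))"
  proof (rule sum.cong[OF refl])
    fix p assume "p \<in> {..<k}"
    then have p: "p < k" by simp
    have len: "length l = k" if "l \<in> ?T" for l using that by (simp add: indices_tensor_power)
    show "(\<Sum>(l, z)\<in>?T \<times> ?I. coef X (l ! p) z * f (l[p := z]) * cnj (g l)) =
        (\<Sum>(l, z)\<in>?T \<times> ?I. f l * (coef X z (l ! p) * cnj (g (l[p := z]))))"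
      \<comment> \<open>The map exchanging the \<open>p\<close>-th entry of \<open>l\<close> with
        \<open>z\<close> is an involution on pairs; it moves the matrix coefficient from one
        argument of the form to the other.\<close>
      by (rule sum.reindex_bij_witness[of _ "\<lambda>(l, z). (l[p := z], l ! p)" "\<lambda>(l, z). (l[p := z], l ! p)"])
        (use p in \<open>auto simp: len tensor_index_update intro: tensor_index_nth\<close>)
  qed
  also have "\<dots> = (\<Sum>l\<in>?T. \<Sum>p<k. \<Sum>z\<in>?I. f l * (coef X z (l ! p) * cnj (g (l[p := z]))))"
    by (subst (2) sum.swap) (simp add: sum.cartesian_product)
  also have "\<dots> = inner_on ?T f (action (tensor_power k M) (conj_transpose X) g)"
  proof -
    have "cnj (coef (conj_transpose X) (l ! p) z) = coef X z (l ! p)"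
      if "l \<in> ?T" "p < k" "z \<in> ?I" for l p z
      using coef_conj_transpose[OF X] tensor_index_nth[OF that(1,2)] that(3) by (simp add: M_def)
    then show ?thesis
      unfolding inner_on_def M_def
      by (intro sum.cong refl) (auto simp: action_tensor_mixed sum_distrib_left intro!: sum.cong)
  qed
  finally show ?thesis .
qed

lemma weights_tensor_mixed:
  fixes a b c N k
  defines "M \<equiv> mixed_module a b c N"
  assumes X: "X \<in> carrier_mat N N" "diagonal_mat X" and f: "f \<in> vspace (tensor_power k M)"
  shows "action (tensor_power k M) X f l = (\<Sum>p<k. coef X (l ! p) (l ! p)) * f l"
proof (cases "l \<in> indices (tensor_power k M)")
  case True
  have d: "coef X y z = 0" if "y \<in> indices M" "z \<in> indices M" "y \<noteq> z" for y z
    using that X unfolding M_def by (elim mixed_index_cases) (auto simp: diagonal_mat_def)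
  have "(\<Sum>z\<in>indices M. coef X (l ! p) z * f (l[p := z])) = coef X (l ! p) (l ! p) * f l" if "p < k" for p
  proof -
    have p: "l ! p \<in> indices M" using True that by (rule tensor_index_nth)
    have "(\<Sum>z\<in>indices M. coef X (l ! p) z * f (l[p := z])) =
        (\<Sum>z\<in>indices M. if z = l ! p then coef X (l ! p) (l ! p) * f l else 0)"
    proof (intro sum.cong refl)
      fix z assume "z \<in> indices M"
      then show "coef X (l ! p) z * f (l[p := z]) = (if z = l ! p then coef X (l ! p) (l ! p) * f l else 0)"
        using d[OF p, of z] by (cases "z = l ! p") simp_all
    qed
    then show ?thesis using p finite_indices_mixed_module by (simp add: M_def)
  qed
  then show ?thesis
    using True unfolding M_def by (simp add: action_tensor_mixed sum_distrib_right)
next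
  case False
  then show ?thesis using f by (auto simp: vspace_def tensor_power_def)
qed

text \<open>A nonzero coefficient of a strictly upper triangular \<open>X\<close> leads from index
  \<open>i\<close> to a larger index in a \<open>V\<close>-factor, but to a smaller one in a dual
  factor because of the transpose. Reversing the order on the dual factors makes the degree grow in
  both cases. Trivial factors have only zero coefficients and get the default degree 0.\<close>

fun degree_of :: "nat \<Rightarrow> mixed_index \<Rightarrow> nat" where
  "degree_of N (Inl (Inl (i, r))) = i"
| "degree_of N (Inl (Inr (i, r))) = N - i"
| "degree_of N (Inr _) = 0"

lemma grading_tensor_mixed:
  fixes a b c N k
  defines "M \<equiv> mixed_module a b c N"
  assumes X: "X \<in> carrier_mat N N" "strictly_upper X" and ne: "action (tensor_power k M) X f l \<noteq> 0"
  shows "\<exists>l'. f l' \<noteq> 0 \<and> (\<Sum>p<k. degree_of N (l ! p)) < (\<Sum>p<k. degree_of N (l' ! p))"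
proof -
  have l: "l \<in> indices (tensor_power k M)" using ne by (auto simp: tensor_power_def split: if_splits)
  then have "(\<Sum>p<k. \<Sum>z\<in>indices M. coef X (l ! p) z * f (l[p := z])) \<noteq> 0"
    using ne unfolding M_def by (simp add: action_tensor_mixed)
  then obtain p where p: "p < k" "(\<Sum>z\<in>indices M. coef X (l ! p) z * f (l[p := z])) \<noteq> 0"
    by (meson lessThan_iff sum.neutral)
  then obtain z where z: "z \<in> indices M" "coef X (l ! p) z * f (l[p := z]) \<noteq> 0"
    by (meson sum.neutral)
  have upper: "i < j" if "X $$ (i, j) \<noteq> 0" "i < N" "j < N" for i j
    using X that unfolding strictly_upper_def by (metis carrier_matD not_le)
  have "degree_of N y < degree_of N z" if y: "y \<in> indices M" and c: "coef X y z \<noteq> 0" for y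
    using c
  proof (cases rule: coef_nonzero_cases)
    case (1 i j r)
    then show ?thesis using y z(1) upper[of i j] by (auto simp: M_def indices_mixed_module)
  next
    case (2 i j r)
    then show ?thesis using y z(1) upper[of j i] by (auto simp: M_def indices_mixed_module)
  qed
  then have lt: "degree_of N (l ! p) < degree_of N z" using z tensor_index_nth[OF l p(1)] by auto
  have "length l = k" using l by (simp add: indices_tensor_power)
  then have "(\<Sum>q<k. degree_of N (l ! q)) < (\<Sum>q<k. degree_of N (l[p := z] ! q))"
    using p(1) lt by (intro sum_strict_mono_ex1) (auto simp: nth_list_update)
  then show ?thesis using z(2) by auto
qed

text \<open>Collects the properties of the tensor module, so that only closure properties of the
  matrix algebra \<open>L\<close> remain to be checked for each type.\<close>

lemma unitary_module_tensor_mixed: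
  assumes carrier: "L \<subseteq> carrier_mat N N"
    and bracket: "\<And>X Y. X \<in> L \<Longrightarrow> Y \<in> L \<Longrightarrow> X * Y - Y * X \<in> L"
    and add: "\<And>X Y. X \<in> L \<Longrightarrow> Y \<in> L \<Longrightarrow> X + Y \<in> L"
    and conj: "\<And>X. X \<in> L \<Longrightarrow> conj_transpose X \<in> L"
    and triangular: "\<And>X. X \<in> L \<Longrightarrow> \<exists>Y D Z. Y \<in> L \<and> strictly_lower Y \<and> D \<in> L \<and> diagonal_mat D \<and>
      Z \<in> L \<and> strictly_upper Z \<and> X = Y + D + Z"
  shows "unitary_module N L (tensor_power k (mixed_module a b c N))"
proof
  show "lie_module L (tensor_power k (mixed_module a b c N))"
    unfolding mixed_module_def
    by (intro lie_module_tensor_power lie_module_direct_sum lie_module_direct_power lie_module_dual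
        lie_module_natural lie_module_trivial carrier bracket)
next
  fix X f g assume "X \<in> L"
  then have "X \<in> carrier_mat N N" using carrier by blast
  then show "inner_on (indices (tensor_power k (mixed_module a b c N)))
      (action (tensor_power k (mixed_module a b c N)) X f) g =
    inner_on (indices (tensor_power k (mixed_module a b c N))) f
      (action (tensor_power k (mixed_module a b c N)) (conj_transpose X) g)"
    by (rule contravariant_tensor_mixed)
next
  fix X assume "X \<in> L" and d: "diagonal_mat X"
  then have "X \<in> carrier_mat N N" using carrier by blast
  from weights_tensor_mixed[OF this d]
  show "\<exists>w. \<forall>f\<in>vspace (tensor_power k (mixed_module a b c N)). \<forall>l.
      action (tensor_power k (mixed_module a b c N)) X f l = w l * f l"
    by (intro exI[of _ "\<lambda>l. \<Sum>p<k. coef X (l ! p) (l ! p)"]) blast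
next
  show "\<exists>\<phi> :: mixed_index list \<Rightarrow> nat. \<forall>X\<in>L. strictly_upper X \<longrightarrow>
      (\<forall>f\<in>vspace (tensor_power k (mixed_module a b c N)). \<forall>l.
        action (tensor_power k (mixed_module a b c N)) X f l \<noteq> 0 \<longrightarrow> (\<exists>j. f j \<noteq> 0 \<and> \<phi> l < \<phi> j))"
    using carrier
    by (intro exI[of _ "\<lambda>l. \<Sum>p<k. degree_of N (l ! p)"] ballI impI allI)
      (rule grading_tensor_mixed[OF subsetD])
qed (use assms in auto)

section \<open>Passing from one rank to the next\<close>

lemma fscale_dim_le_of_injective:
  assumes fin: "finite (indices M)" "finite (indices M')"
    and U: "U \<subseteq> vspace M'" "fscale.subspace U" and V: "V \<subseteq> vspace M"
    and lin: "Vector_Spaces.linear fscale fscale P"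
    and img: "P ` U \<subseteq> V" and inj: "\<And>u. u \<in> U \<Longrightarrow> P u = 0 \<Longrightarrow> u = 0"
  shows "fscale.dim U \<le> fscale.dim V"
proof -
  interpret P: Vector_Spaces.linear fscale fscale P by (rule lin)
  interpret vector_space_pair fscale fscale by unfold_locales
  obtain B where B: "finite B" "B \<subseteq> U" "fscale.independent B" "U \<subseteq> fscale.span B"
    "card B = fscale.dim U"
    by (rule fscale_basis[OF fin(2) U(1)])
  have injU: "inj_on P U"
  proof (rule inj_onI)
    fix u v assume "u \<in> U" "v \<in> U" "P u = P v"
    then have "u - v \<in> U" "P (u - v) = 0"
      using fscale.subspace_diff[OF U(2)] P.diff[of u v] by simp_all
    then show "u = v" using inj[of "u - v"] by (metis eq_iff_diff_eq_0)
  qed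
  have "fscale.span B \<subseteq> U" using B(2) U(2) by (rule fscale.span_minimal)
  then have "inj_on P (fscale.span B)" using injU by (rule inj_on_subset[rotated])
  then have "fscale.independent (P ` B)"
    using B(3) by (intro linear_independent_injective_image[OF lin])
  moreover have "P ` B \<subseteq> V" using B(2) img by blast
  ultimately have "card (P ` B) \<le> fscale.dim V" by (rule card_le_fscale_dim(2)[OF fin(1) V])
  moreover have "card (P ` B) = card B"
    using inj_on_subset[OF injU B(2)] by (rule card_image)
  ultimately show ?thesis using B(5) by simp
qed

text \<open>The value at \<open>Inr\<close> is junk: it only enlarges the set of indices a fresh index has to avoid.\<close>

fun mixed_coord :: "mixed_index \<Rightarrow> nat" where
  "mixed_coord (Inl (Inl (i, r))) = i"
| "mixed_coord (Inl (Inr (i, r))) = i"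
| "mixed_coord (Inr u) = 0"

fun omitted :: "nat set \<Rightarrow> mixed_index \<Rightarrow> bool" where
  "omitted B (Inl (Inl (i, r))) = (i \<in> B)"
| "omitted B (Inl (Inr (i, r))) = (i \<in> B)"
| "omitted B (Inr u) = False"

definition reindex :: "(nat \<Rightarrow> nat) \<Rightarrow> mixed_index \<Rightarrow> mixed_index" where
  "reindex \<iota> = map_sum (map_sum (map_prod \<iota> id) (map_prod \<iota> id)) id"

lemma reindex_simps [simp]:
  "reindex \<iota> (Inl (Inl (i, r))) = Inl (Inl (\<iota> i, r))"
  "reindex \<iota> (Inl (Inr (i, r))) = Inl (Inr (\<iota> i, r))"
  "reindex \<iota> (Inr u) = Inr u"
  by (simp_all add: reindex_def)

text \<open>\<open>B\<close> is the set of indices of the larger natural module omitted by the embedding \<open>\<iota>\<close>, and \<open>S\<close>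
  stands for the indices that occur in a given basis tensor.\<close>

locale rank_step =
  fixes N N' :: nat and L L' :: "complex mat set" and \<iota> :: "nat \<Rightarrow> nat" and B :: "nat set" and k :: nat
  assumes carrier: "L \<subseteq> carrier_mat N N" "L' \<subseteq> carrier_mat N' N'"
    and incl_less: "i < j \<Longrightarrow> j < N \<Longrightarrow> \<iota> i < \<iota> j"
    and incl_range: "\<iota> ` {..<N} = {..<N'} - B"
    and extension: "X \<in> L \<Longrightarrow> \<exists>X'\<in>L'. (\<forall>i<N. \<forall>j<N. X' $$ (\<iota> i, \<iota> j) = X $$ (i, j)) \<and>
      (\<forall>i<N'. \<forall>j<N'. i \<in> B \<or> j \<in> B \<longrightarrow> X' $$ (i, j) = 0)"
    and row: "x \<in> B \<Longrightarrow> x < N' \<Longrightarrow> finite S \<Longrightarrow> card S \<le> k \<Longrightarrow>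
      \<exists>i X. i < N' \<and> i \<notin> B \<and> X \<in> L' \<and> strictly_upper X \<and>
        (\<forall>v<N'. X $$ (i, v) = (if v = x then 1 else 0)) \<and>
        (\<forall>v\<in>S. \<forall>w\<in>B. v < N' \<longrightarrow> w < N' \<longrightarrow> X $$ (v, w) = 0 \<and> X $$ (w, v) = 0)"
    and col: "x \<in> B \<Longrightarrow> x < N' \<Longrightarrow> finite S \<Longrightarrow> card S \<le> k \<Longrightarrow>
      \<exists>i X. i < N' \<and> i \<notin> B \<and> X \<in> L' \<and> strictly_upper X \<and>
        (\<forall>v<N'. X $$ (v, i) = (if v = x then 1 else 0)) \<and>
        (\<forall>v\<in>S. \<forall>w\<in>B. v < N' \<longrightarrow> w < N' \<longrightarrow> X $$ (v, w) = 0 \<and> X $$ (w, v) = 0)"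
begin

text \<open>Induction on the number of omitted entries: an element \<open>X\<close> whose \<open>i\<close>-th row is the \<open>x\<close>-th unit
  vector, with \<open>i\<close> fresh, trades an omitted entry \<open>x\<close> of a \<open>V\<close>-factor for terms with fewer omitted
  entries; dually, columns serve the \<open>V\<^sup>*\<close>-factors.\<close>

lemma hw_vector_eq_0:
  fixes a b c
  defines "M \<equiv> mixed_module a b c N'"
  assumes u: "u \<in> hw_space L' (tensor_power k M)"
    and u0: "\<And>l. l \<in> indices (tensor_power k M) \<Longrightarrow> (\<And>y. y \<in> set l \<Longrightarrow> \<not> omitted B y) \<Longrightarrow> u l = 0"
  shows "u = 0"
proof -
  let ?T = "indices (tensor_power k M)"
  define num where "num l = (\<Sum>p<k. if omitted B (l ! p) then 1 else 0 :: nat)" for l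
  have "l \<in> ?T \<longrightarrow> u l = 0" for l
  proof (induction "num l" arbitrary: l rule: less_induct)
    case less
    show ?case
    proof (cases "\<exists>y\<in>set l. omitted B y")
      case False
      then show ?thesis using u0 by blast
    next
      case True
      show ?thesis
      proof
        assume l: "l \<in> ?T"
        then have len: "length l = k" by (simp add: indices_tensor_power)
        obtain p where p: "p < k" "omitted B (l ! p)"
          using True len by (metis in_set_conv_nth)
        have lp: "l ! p \<in> indices M" using l p(1) by (rule tensor_index_nth)
        define S where "S = mixed_coord ` set l"
        have S: "finite S" "card S \<le> k"
          using card_image_le[of "set l" mixed_coord] card_length[of l] len by (auto simp: S_def)
        \<comment> \<open>Position \<open>p\<close> loses its omitted entry and position
          \<open>q\<close> receives none, so the number of omitted entries drops.\<close>
        have IH: "u (l[p := y, q := z]) = 0"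
          if "q < k" "q \<noteq> p" "\<not> omitted B y" "\<not> omitted B z" "y \<in> indices M" "z \<in> indices M" for y z q
        proof -
          have "num (l[p := y, q := z]) < num l"
            unfolding num_def
            using that p len by (intro sum_strict_mono_ex1) (auto simp: nth_list_update)
          moreover have "l[p := y, q := z] \<in> ?T" using that l by (intro tensor_index_update)
          ultimately show ?thesis using less by blast
        qed
        have key: "u l = 0"
          if X: "X \<in> L'" "strictly_upper X" and y: "y \<in> indices M" "\<not> omitted B y"
            and s: "s \<noteq> 0" "\<And>z. z \<in> indices M \<Longrightarrow> coef X y z = (if z = l ! p then s else 0)"
            and XS: "\<And>v w. v \<in> S \<Longrightarrow> w \<in> B \<Longrightarrow> v < N' \<Longrightarrow> w < N' \<Longrightarrow> X $$ (v, w) = 0 \<and> X $$ (w, v) = 0"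
          for X y s
        proof -
          have T: "l[p := y] \<in> ?T" using l y(1) by (rule tensor_index_update)
          \<comment> \<open>The coordinate of \<open>X u\<close> at \<open>l[p := y]\<close> is
            zero. Row \<open>y\<close> of \<open>X\<close> meets only \<open>l ! p\<close>, so the
            \<open>p\<close>-th summand is \<open>s * u l\<close>; the remaining summands are shown
            to vanish.\<close>
          have "action (tensor_power k M) X u = 0" using u X by (simp add: hw_space_def)
          then have "0 = (\<Sum>q<k. \<Sum>z\<in>indices M. coef X (l[p := y] ! q) z * u (l[p := y, q := z]))"
            using action_tensor_mixed[OF T[unfolded M_def], of X u] by (simp add: M_def)
          also have "\<dots> = (\<Sum>q<k. if q = p then s * u l else 0)"
          proof (rule sum.cong[OF refl])
            fix q assume "q \<in> {..<k}"
            then have q: "q < k" by simp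
            show "(\<Sum>z\<in>indices M. coef X (l[p := y] ! q) z * u (l[p := y, q := z])) =
                (if q = p then s * u l else 0)"
            proof (cases "q = p")
              case True
              have "(\<Sum>z\<in>indices M. coef X (l[p := y] ! q) z * u (l[p := y, q := z])) =
                  (\<Sum>z\<in>indices M. if z = l ! p then s * u l else 0)"
                using True p len s(2) by (intro sum.cong) auto
              then show ?thesis
                using True lp finite_indices_mixed_module by (simp add: M_def)
            next
              case False
              \<comment> \<open>The coordinate of \<open>l ! q\<close> belongs to \<open>S\<close>,
                so no nonzero coefficient leads from it to an omitted \<open>z\<close>, even when
                \<open>l ! q\<close> is omitted itself.\<close>
              have "coef X (l ! q) z * u (l[p := y, q := z]) = 0" if z: "z \<in> indices M" for z
              proof (cases "coef X (l ! q) z = 0")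
                case nz: False
                have lq: "l ! q \<in> indices M" "mixed_coord (l ! q) \<in> S"
                  using tensor_index_nth[OF l q] q len by (auto simp: S_def)
                have "\<not> omitted B z"
                  using nz
                proof (cases rule: coef_nonzero_cases)
                  case (1 i j r)
                  then show ?thesis using lq z XS[of i j] by (auto simp: M_def indices_mixed_module)
                next
                  case (2 i j r)
                  then show ?thesis using lq z XS[of i j] by (auto simp: M_def indices_mixed_module)
                qed
                then show ?thesis using IH[OF q False y(2) _ y(1) z] by simp
              qed simp
              then show ?thesis using False by (simp add: sum.neutral)
            qed
          qed
          also have "\<dots> = s * u l" using p(1) by simp
          finally show ?thesis using s(1) by simp
        qed
        from lp p(2) consider (V) x r where "l ! p = Inl (Inl (x, r))" "x \<in> B" "x < N'" "r < a"
          | (W) x r where "l ! p = Inl (Inr (x, r))" "x \<in> B" "x < N'" "r < b"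
          unfolding M_def by (elim mixed_index_cases) auto
        then show "u l = 0"
        proof cases
          case V
          obtain i X where "i < N'" "i \<notin> B" "X \<in> L'" "strictly_upper X"
            "\<And>v. v < N' \<Longrightarrow> X $$ (i, v) = (if v = x then 1 else 0)"
            "\<And>v w. v \<in> S \<Longrightarrow> w \<in> B \<Longrightarrow> v < N' \<Longrightarrow> w < N' \<Longrightarrow> X $$ (v, w) = 0 \<and> X $$ (w, v) = 0"
            using row[OF V(2,3) S] by blast
          then show ?thesis
            using V by (intro key[of X "Inl (Inl (i, r))" 1])
              (auto simp: M_def indices_mixed_module split: if_splits)
        next
          case W
          obtain i X where "i < N'" "i \<notin> B" "X \<in> L'" "strictly_upper X"
            "\<And>v. v < N' \<Longrightarrow> X $$ (v, i) = (if v = x then 1 else 0)"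
            "\<And>v w. v \<in> S \<Longrightarrow> w \<in> B \<Longrightarrow> v < N' \<Longrightarrow> w < N' \<Longrightarrow> X $$ (v, w) = 0 \<and> X $$ (w, v) = 0"
            using col[OF W(2,3) S] by blast
          \<comment> \<open>The scalar is -1 because a dual factor carries minus the transpose: a
            column of \<open>X\<close> acts as a row.\<close>
          then show ?thesis
            using W by (intro key[of X "Inl (Inr (i, r))" "-1"])
              (auto simp: M_def indices_mixed_module split: if_splits)
        qed
      qed
    qed
  qed
  moreover have "u l = 0" if "l \<notin> ?T" for l
    using u that by (auto simp: hw_space_def vspace_def)
  ultimately show ?thesis by (auto simp: fun_eq_iff)
qed

section \<open>Restriction of tensors along the embedding of indices\<close>

lemma incl_inj: "i < N \<Longrightarrow> j < N \<Longrightarrow> \<iota> i = \<iota> j \<longleftrightarrow> i = j"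
  by (metis incl_less less_irrefl linorder_neqE_nat)

lemma incl_lt: "i < N \<Longrightarrow> \<iota> i < N'" and incl_notin: "i < N \<Longrightarrow> \<iota> i \<notin> B"
  using incl_range by auto

lemma ex_incl: "i < N' \<Longrightarrow> i \<notin> B \<Longrightarrow> \<exists>j<N. i = \<iota> j"
  using incl_range by (metis DiffI imageE lessThan_iff)

lemma reindex_inj: "inj_on (reindex \<iota>) (indices (mixed_module a b c N))"
  by (rule inj_onI) (elim mixed_index_cases, auto simp: incl_inj)

lemma reindex_image:
  "reindex \<iota> ` indices (mixed_module a b c N) = {y \<in> indices (mixed_module a b c N'). \<not> omitted B y}"
proof (intro equalityI subsetI)
  fix y assume "y \<in> reindex \<iota> ` indices (mixed_module a b c N)"
  then show "y \<in> {y \<in> indices (mixed_module a b c N'). \<not> omitted B y}"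
    by (elim imageE mixed_index_cases)
      (auto simp: indices_mixed_module incl_lt incl_notin)
next
  fix y assume "y \<in> {y \<in> indices (mixed_module a b c N'). \<not> omitted B y}"
  then have y: "y \<in> indices (mixed_module a b c N')" "\<not> omitted B y" by auto
  from y(1) show "y \<in> reindex \<iota> ` indices (mixed_module a b c N)"
  proof (cases rule: mixed_index_cases)
    case (1 i r)
    then obtain j where "j < N" "i = \<iota> j" using y(2) ex_incl by auto
    then show ?thesis
      using 1 by (intro image_eqI[of _ _ "Inl (Inl (j, r))"]) (auto simp: indices_mixed_module)
  next
    case (2 i r)
    then obtain j where "j < N" "i = \<iota> j" using y(2) ex_incl by auto
    then show ?thesis
      using 2 by (intro image_eqI[of _ _ "Inl (Inr (j, r))"]) (auto simp: indices_mixed_module)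
  next
    case (3 r)
    then show ?thesis
      by (intro image_eqI[of _ _ "Inr ((), r)"]) (auto simp: indices_mixed_module)
  qed
qed

text \<open>The extended matrix vanishes in all omitted rows and columns, so only the embedded
  indices contribute to the sum over the larger index set.\<close>

lemma sum_coef_reindex:
  assumes X': "\<And>i j. i < N \<Longrightarrow> j < N \<Longrightarrow> X' $$ (\<iota> i, \<iota> j) = X $$ (i, j)"
    "\<And>i j. i < N' \<Longrightarrow> j < N' \<Longrightarrow> i \<in> B \<or> j \<in> B \<Longrightarrow> X' $$ (i, j) = 0"
    and y: "y \<in> indices (mixed_module a b c N)"
  shows "(\<Sum>z\<in>indices (mixed_module a b c N'). coef X' (reindex \<iota> y) z * g z) =
    (\<Sum>z\<in>indices (mixed_module a b c N). coef X y z * g (reindex \<iota> z))"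
proof -
  let ?I = "indices (mixed_module a b c N)" and ?I' = "indices (mixed_module a b c N')"
  have "coef X' (reindex \<iota> y) z = 0" if z: "z \<in> ?I' - reindex \<iota> ` ?I" for z
  proof (rule ccontr)
    assume "coef X' (reindex \<iota> y) z \<noteq> 0"
    moreover have "omitted B z" "z \<in> ?I'" "reindex \<iota> y \<in> ?I'" using z y reindex_image by blast+
    ultimately show False
      using X'(2) by (elim coef_nonzero_cases) (auto simp: indices_mixed_module)
  qed
  then have "(\<Sum>z\<in>?I'. coef X' (reindex \<iota> y) z * g z) =
      (\<Sum>z\<in>reindex \<iota> ` ?I. coef X' (reindex \<iota> y) z * g z)"
    using reindex_image by (intro sum.mono_neutral_right finite_indices_mixed_module) auto
  also have "\<dots> = (\<Sum>z\<in>?I. coef X' (reindex \<iota> y) (reindex \<iota> z) * g (reindex \<iota> z))"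
    using reindex_inj by (simp add: sum.reindex)
  also have "\<dots> = (\<Sum>z\<in>?I. coef X y z * g (reindex \<iota> z))"
  proof (rule sum.cong[OF refl])
    fix z assume "z \<in> ?I"
    then have "coef X' (reindex \<iota> y) (reindex \<iota> z) = coef X y z"
      using y X'(1) by (elim mixed_index_cases) auto
    then show "coef X' (reindex \<iota> y) (reindex \<iota> z) * g (reindex \<iota> z) = coef X y z * g (reindex \<iota> z)"
      by simp
  qed
  finally show ?thesis .
qed

definition restrict_tensor ::
  "mixed_index list set \<Rightarrow> (mixed_index list \<Rightarrow> complex) \<Rightarrow> mixed_index list \<Rightarrow> complex" where
  "restrict_tensor T u = (\<lambda>l. if l \<in> T then u (map (reindex \<iota>) l) else 0)"

text \<open>Restriction of coordinates intertwines \<open>X\<close> with its extension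
  \<open>X'\<close>, so it maps highest weight vectors to highest weight vectors. It is injective on
  them by \<open>hw_vector_eq_0\<close>: vanishing of the restriction means vanishing at all tensors
  without omitted entries.\<close>

lemma dim_hw_space_le:
  fixes a b c
  defines "M \<equiv> mixed_module a b c N" and "M' \<equiv> mixed_module a b c N'"
  assumes lie: "lie_module L' (tensor_power k M')"
  shows "fscale.dim (hw_space L' (tensor_power k M')) \<le> fscale.dim (hw_space L (tensor_power k M))"
proof (rule fscale_dim_le_of_injective)
  let ?T = "indices (tensor_power k M)" and ?T' = "indices (tensor_power k M')"
  have fin: "finite (indices (tensor_power k (mixed_module a b c m)))" for m
    using finite_lists_length_eq[OF finite_indices_mixed_module, of a b c m k]
    by (simp add: tensor_power_def conj_commute)
  show "finite ?T" "finite ?T'" unfolding M_def M'_def by (rule fin)+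
  show "hw_space L' (tensor_power k M') \<subseteq> vspace (tensor_power k M')"
    "hw_space L (tensor_power k M) \<subseteq> vspace (tensor_power k M)"
    by (auto simp: hw_space_def)
  show "fscale.subspace (hw_space L' (tensor_power k M'))"
    using lie by (rule subspace_hw_space)
  show "Vector_Spaces.linear fscale fscale (restrict_tensor ?T)"
    by unfold_locales (auto simp: restrict_tensor_def fscale_def fun_eq_iff)
  show "restrict_tensor ?T ` hw_space L' (tensor_power k M') \<subseteq> hw_space L (tensor_power k M)"
  proof safe
    fix u assume u: "u \<in> hw_space L' (tensor_power k M')"
    have v: "restrict_tensor ?T u \<in> vspace (tensor_power k M)" by (auto simp: restrict_tensor_def vspace_def)
    have "action (tensor_power k M) X (restrict_tensor ?T u) = 0" if X: "X \<in> L" "strictly_upper X" for X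
    proof
      fix l
      obtain X' where X': "X' \<in> L'" "\<And>i j. i < N \<Longrightarrow> j < N \<Longrightarrow> X' $$ (\<iota> i, \<iota> j) = X $$ (i, j)"
        "\<And>i j. i < N' \<Longrightarrow> j < N' \<Longrightarrow> i \<in> B \<or> j \<in> B \<Longrightarrow> X' $$ (i, j) = 0"
        using extension[OF X(1)] by blast
      \<comment> \<open>Since \<open>\<iota>\<close> is increasing, the extension of a strictly
        upper triangular matrix is strictly upper triangular.\<close>
      have "X' $$ (i, j) = 0" if ij: "i < N'" "j < N'" "j \<le> i" for i j
      proof (cases "i \<in> B \<or> j \<in> B")
        case False
        then obtain i0 j0 where "i0 < N" "i = \<iota> i0" "j0 < N" "j = \<iota> j0"
          using ex_incl ij by meson
        moreover from this have "j0 \<le> i0" using ij incl_less[of i0 j0] by (meson leD leI)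
        ultimately show ?thesis
          using X carrier(1) X'(2)[of i0 j0] by (auto simp: strictly_upper_def)
      qed (use X'(3) ij in blast)
      moreover have "X' \<in> carrier_mat N' N'" using X'(1) carrier(2) by blast
      ultimately have "strictly_upper X'" by (auto simp: strictly_upper_def)
      then have zero: "action (tensor_power k M') X' u = 0" using u X'(1) by (simp add: hw_space_def)
      show "action (tensor_power k M) X (restrict_tensor ?T u) l = 0 l"
      proof (cases "l \<in> ?T")
        case True
        have T': "map (reindex \<iota>) l \<in> ?T'"
          using True reindex_image[of a b c] by (auto simp: indices_tensor_power M_def M'_def)
        have "action (tensor_power k M) X (restrict_tensor ?T u) l =
            (\<Sum>p<k. \<Sum>z\<in>indices M. coef X (l ! p) z * u (map (reindex \<iota>) (l[p := z])))"
          using action_tensor_mixed[OF True[unfolded M_def], of X "restrict_tensor ?T u"]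
            tensor_index_update[OF True]
          by (simp add: M_def restrict_tensor_def)
        also have "\<dots> = (\<Sum>p<k. \<Sum>z\<in>indices M'. coef X' (map (reindex \<iota>) l ! p) z *
            u ((map (reindex \<iota>) l)[p := z]))"
        proof (rule sum.cong[OF refl])
          fix p assume "p \<in> {..<k}"
          then have p: "p < k" by simp
          have len: "length l = k" using True by (simp add: indices_tensor_power)
          have lp: "l ! p \<in> indices M" using True p by (rule tensor_index_nth)
          show "(\<Sum>z\<in>indices M. coef X (l ! p) z * u (map (reindex \<iota>) (l[p := z]))) =
            (\<Sum>z\<in>indices M'. coef X' (map (reindex \<iota>) l ! p) z * u ((map (reindex \<iota>) l)[p := z]))"
            using sum_coef_reindex[OF X'(2,3) lp[unfolded M_def],
                where g = "\<lambda>z. u ((map (reindex \<iota>) l)[p := z])"] p len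
            by (simp add: M_def M'_def map_update)
        qed
        also have "\<dots> = action (tensor_power k M') X' u (map (reindex \<iota>) l)"
          using action_tensor_mixed[OF T'[unfolded M'_def]] by (simp add: M'_def)
        finally show ?thesis using zero by simp
      qed (auto simp: tensor_power_def)
    qed
    then show "restrict_tensor ?T u \<in> hw_space L (tensor_power k M)" using v by (simp add: hw_space_def)
  qed
  fix u assume u: "u \<in> hw_space L' (tensor_power k M')" and z: "restrict_tensor ?T u = 0"
  show "u = 0"
  proof (rule hw_vector_eq_0[OF u[unfolded M'_def]])
    fix l assume l: "l \<in> indices (tensor_power k (mixed_module a b c N'))" "\<And>y. y \<in> set l \<Longrightarrow> \<not> omitted B y"
    then have "set l \<subseteq> reindex \<iota> ` indices M"
      unfolding reindex_image M_def by (auto simp: indices_tensor_power)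
    then have "l \<in> lists (reindex \<iota> ` indices M)" by auto
    then obtain l0 where l0: "set l0 \<subseteq> indices M" "l = map (reindex \<iota>) l0"
      by (auto simp: lists_image)
    then have "l0 \<in> ?T" using l(1) by (simp add: indices_tensor_power)
    then have "restrict_tensor ?T u l0 = u l" using l0 by (simp add: restrict_tensor_def)
    then show "u l = 0" using z by simp
  qed
qed

end

section \<open>The classical algebras\<close>

text \<open>A common shape for the symmetric and the alternating form, with the sign of each row as
  parameter, so that types B, C and D can be treated together.\<close>

definition anti_form :: "nat \<Rightarrow> (nat \<Rightarrow> complex) \<Rightarrow> complex mat" where
  "anti_form N \<epsilon> = mat N N (\<lambda>(i, j). if i + j + 1 = N then \<epsilon> i else 0)"

lemma sym_form_eq: "sym_form N = anti_form N (\<lambda>_. 1)"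
  by (simp add: sym_form_def anti_form_def)

text \<open>On the antidiagonal, where \<open>i + j + 1 = N\<close>, the condition
  \<open>i < j\<close> means \<open>2 * i + 1 < N\<close>.\<close>

lemma alt_form_eq: "alt_form N = anti_form N (\<lambda>i. if 2 * i + 1 < N then 1 else - 1)"
  unfolding alt_form_def anti_form_def by (intro eq_matI) auto

text \<open>Each row and column of the form has a single nonzero entry, so each product contributes
  one term. Reading the matrix equation at \<open>(j, N - 1 - i)\<close> ties the entry
  \<open>(i, j)\<close> of \<open>X\<close> to its mirror image in the antidiagonal.\<close>

lemma form_algebra_anti_form:
  "X \<in> form_algebra N (anti_form N \<epsilon>) \<longleftrightarrow> X \<in> carrier_mat N N \<and>
    (\<forall>i<N. \<forall>j<N. \<epsilon> i * X $$ (i, j) + \<epsilon> j * X $$ (N - 1 - j, N - 1 - i) = 0)"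
proof (cases "X \<in> carrier_mat N N")
  case X: True
  let ?J = "anti_form N \<epsilon>"
  have entry: "(transpose_mat X * ?J + ?J * X) $$ (j, N - 1 - i) =
      \<epsilon> i * X $$ (i, j) + \<epsilon> j * X $$ (N - 1 - j, N - 1 - i)" if "i < N" "j < N" for i j
  proof -
    have "(\<Sum>m<N. X $$ (m, j) * ?J $$ (m, N - 1 - i)) = (\<Sum>m<N. if m = i then \<epsilon> i * X $$ (i, j) else 0)"
      using that by (intro sum.cong) (auto simp: anti_form_def)
    moreover have "(\<Sum>m<N. ?J $$ (j, m) * X $$ (m, N - 1 - i)) =
        (\<Sum>m<N. if m = N - 1 - j then \<epsilon> j * X $$ (N - 1 - j, N - 1 - i) else 0)"
      using that by (intro sum.cong) (auto simp: anti_form_def)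
    moreover have "?J \<in> carrier_mat N N" by (simp add: anti_form_def)
    ultimately show ?thesis using X that by (simp add: scalar_prod_def atLeast0LessThan)
  qed
  have "transpose_mat X * ?J + ?J * X = 0\<^sub>m N N \<longleftrightarrow>
      (\<forall>i<N. \<forall>j<N. (transpose_mat X * ?J + ?J * X) $$ (j, N - 1 - i) = 0)" (is "?E \<longleftrightarrow> ?R")
  proof
    assume r: ?R
    show ?E
    proof (rule eq_matI)
      fix i j assume "i < dim_row (0\<^sub>m N N)" "j < dim_col (0\<^sub>m N N)"
      then have "i < N" "j < N" "N - 1 - (N - 1 - j) = j" "N - 1 - j < N" by auto
      then show "(transpose_mat X * ?J + ?J * X) $$ (i, j) = 0\<^sub>m N N $$ (i, j)"
        using r by (metis index_zero_mat(1))
    qed (use X in \<open>auto simp: anti_form_def\<close>)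
  qed simp
  then show ?thesis using X entry by (simp add: form_algebra_def)
qed (simp add: form_algebra_def)

section \<open>Triangular parts and extension by zero\<close>

definition mat_part :: "(nat \<Rightarrow> nat \<Rightarrow> bool) \<Rightarrow> complex mat \<Rightarrow> complex mat" where
  "mat_part R X = mat (dim_row X) (dim_col X) (\<lambda>(i, j). if R i j then X $$ (i, j) else 0)"

lemma triangular_parts:
  assumes "X \<in> carrier_mat N N"
    and "mat_part (\<lambda>i j. j < i) X \<in> L" "mat_part (=) X \<in> L" "mat_part (<) X \<in> L"
  shows "\<exists>Y D Z. Y \<in> L \<and> strictly_lower Y \<and> D \<in> L \<and> diagonal_mat D \<and>
      Z \<in> L \<and> strictly_upper Z \<and> X = Y + D + Z"
proof (intro exI conjI)
  show "X = mat_part (\<lambda>i j. j < i) X + mat_part (=) X + mat_part (<) X"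
    by (intro eq_matI) (auto simp: mat_part_def)
qed (use assms in \<open>auto simp: mat_part_def strictly_lower_def strictly_upper_def diagonal_mat_def\<close>)

definition extend_mat :: "(nat \<Rightarrow> nat) \<Rightarrow> nat \<Rightarrow> nat \<Rightarrow> complex mat \<Rightarrow> complex mat" where
  "extend_mat \<iota> N N' X = mat N' N' (\<lambda>(p, q). if p \<in> \<iota> ` {..<N} \<and> q \<in> \<iota> ` {..<N}
    then X $$ (inv_into {..<N} \<iota> p, inv_into {..<N} \<iota> q) else 0)"

lemma extend_mat_index:
  assumes "inj_on \<iota> {..<N}" "\<iota> ` {..<N} \<subseteq> {..<N'}"
  shows "i < N \<Longrightarrow> j < N \<Longrightarrow> extend_mat \<iota> N N' X $$ (\<iota> i, \<iota> j) = X $$ (i, j)"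
    and "p < N' \<Longrightarrow> q < N' \<Longrightarrow> p \<notin> \<iota> ` {..<N} \<or> q \<notin> \<iota> ` {..<N} \<Longrightarrow> extend_mat \<iota> N N' X $$ (p, q) = 0"
  using assms by (auto simp: extend_mat_def inv_into_f_f image_subset_iff)

lemma sl_algebra_add:
  "X \<in> sl_algebra N \<Longrightarrow> Y \<in> sl_algebra N \<Longrightarrow> X + Y \<in> sl_algebra N"
  by (auto simp: sl_algebra_def sum.distrib)

lemma sl_algebra_conj_transpose:
  assumes "X \<in> sl_algebra N" shows "conj_transpose X \<in> sl_algebra N"
proof -
  have "(\<Sum>i<N. conj_transpose X $$ (i, i)) = cnj (\<Sum>i<N. X $$ (i, i))"
    unfolding cnj_sum using assms by (intro sum.cong) (auto simp: sl_algebra_def conj_transpose_def)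
  also have "(\<Sum>i<N. X $$ (i, i)) = 0" using assms by (simp add: sl_algebra_def)
  finally have "(\<Sum>i<N. conj_transpose X $$ (i, i)) = 0" by simp
  moreover have "conj_transpose X \<in> carrier_mat N N"
    using assms by (auto simp: sl_algebra_def conj_transpose_def)
  ultimately show ?thesis by (simp add: sl_algebra_def)
qed

text \<open>The part contains the whole diagonal or none of it, so its trace is that of
  \<open>X\<close> or zero.\<close>

lemma sl_algebra_part:
  assumes "X \<in> sl_algebra N" and "(\<forall>i. R i i) \<or> (\<forall>i. \<not> R i i)" shows "mat_part R X \<in> sl_algebra N"
proof -
  have "(\<Sum>i<N. mat_part R X $$ (i, i)) = (\<Sum>i<N. if R 0 0 then X $$ (i, i) else 0)"
    using assms by (intro sum.cong) (auto simp: sl_algebra_def mat_part_def)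
  then show ?thesis using assms by (auto simp: sl_algebra_def mat_part_def)
qed

lemma sl_algebra_extend_mat:
  assumes "inj_on \<iota> {..<N}" "\<iota> ` {..<N} \<subseteq> {..<N'}" and X: "X \<in> sl_algebra N"
  shows "extend_mat \<iota> N N' X \<in> sl_algebra N'"
proof -
  have "(\<Sum>i<N'. extend_mat \<iota> N N' X $$ (i, i)) = (\<Sum>i\<in>\<iota> ` {..<N}. extend_mat \<iota> N N' X $$ (i, i))"
    using assms(2) extend_mat_index(2)[OF assms(1,2)] by (intro sum.mono_neutral_right) auto
  also have "\<dots> = (\<Sum>i<N. X $$ (i, i))"
    using extend_mat_index(1)[OF assms(1,2)] by (simp add: sum.reindex[OF assms(1)])
  finally show ?thesis using X by (simp add: sl_algebra_def extend_mat_def)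
qed

section \<open>Orthogonal and symplectic algebras in coordinates\<close>

text \<open>\<open>\<tau>\<close> is 1 for a symmetric form and -1 for an alternating one.\<close>

locale anti_form_signs =
  fixes N :: nat and \<epsilon> :: "nat \<Rightarrow> complex" and \<tau> :: complex
  assumes sign: "\<epsilon> i = 1 \<or> \<epsilon> i = - 1"
    and sign_opposite: "i < N \<Longrightarrow> \<epsilon> (N - 1 - i) = \<tau> * \<epsilon> i"
begin

lemma tau_square: "i < N \<Longrightarrow> \<tau> * \<tau> = 1"
  using sign_opposite[of i] sign_opposite[of "N - 1 - i"] sign[of i] by auto

lemma form_algebra_add:
  assumes "X \<in> form_algebra N (anti_form N \<epsilon>)" "Y \<in> form_algebra N (anti_form N \<epsilon>)"
  shows "X + Y \<in> form_algebra N (anti_form N \<epsilon>)"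
  unfolding form_algebra_anti_form
proof (intro conjI allI impI)
  fix i j assume "i < N" "j < N"
  moreover from this have "\<epsilon> i * X $$ (i, j) + \<epsilon> j * X $$ (N - 1 - j, N - 1 - i) = 0"
    "\<epsilon> i * Y $$ (i, j) + \<epsilon> j * Y $$ (N - 1 - j, N - 1 - i) = 0"
    using assms by (auto simp: form_algebra_anti_form)
  ultimately show "\<epsilon> i * (X + Y) $$ (i, j) + \<epsilon> j * (X + Y) $$ (N - 1 - j, N - 1 - i) = 0"
    using assms by (auto simp: form_algebra_anti_form algebra_simps)
qed (use assms in \<open>auto simp: form_algebra_anti_form\<close>)

lemma form_algebra_conj_transpose:
  assumes "X \<in> form_algebra N (anti_form N \<epsilon>)"
  shows "conj_transpose X \<in> form_algebra N (anti_form N \<epsilon>)"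
  unfolding form_algebra_anti_form
proof (intro conjI allI impI)
  fix i j assume ij: "i < N" "j < N"
  then have "\<epsilon> j * X $$ (j, i) + \<epsilon> i * X $$ (N - 1 - i, N - 1 - j) = 0"
    using assms by (auto simp: form_algebra_anti_form)
  then have "cnj (\<epsilon> j * X $$ (j, i) + \<epsilon> i * X $$ (N - 1 - i, N - 1 - j)) = 0" by simp
  \<comment> \<open>The conjugated equation is multiplied by
    \<open>\<epsilon> i * \<epsilon> j\<close>, using that the signs are real with square 1.\<close>
  then have "\<epsilon> i * cnj (X $$ (j, i)) + \<epsilon> j * cnj (X $$ (N - 1 - i, N - 1 - j)) = 0"
    using sign[of i] sign[of j] by (auto simp: add_eq_0_iff)
  then show "\<epsilon> i * conj_transpose X $$ (i, j) + \<epsilon> j * conj_transpose X $$ (N - 1 - j, N - 1 - i) = 0"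
    using assms ij by (auto simp: form_algebra_anti_form conj_transpose_def)
qed (use assms in \<open>auto simp: form_algebra_anti_form conj_transpose_def\<close>)

text \<open>The algebra is cut out by relations between an entry and its mirror image in the
  antidiagonal, so it is closed under selections symmetric in that reflection. The strictly lower
  part, the diagonal and the strictly upper part are such selections.\<close>

lemma form_algebra_part:
  assumes "X \<in> form_algebra N (anti_form N \<epsilon>)"
    and R: "\<And>i j. i < N \<Longrightarrow> j < N \<Longrightarrow> R (N - 1 - j) (N - 1 - i) = R i j"
  shows "mat_part R X \<in> form_algebra N (anti_form N \<epsilon>)"
  using assms(1) unfolding form_algebra_anti_form by (auto simp: mat_part_def R[simplified])

text \<open>The embedding commutes with reversal of the indices and keeps the signs, so mirror
  entries go to mirror entries with the same relation.\<close>

lemma form_algebra_extend_mat: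
  assumes \<iota>: "inj_on \<iota> {..<M}" "\<iota> ` {..<M} \<subseteq> {..<N}"
    and opp: "\<And>i. i < M \<Longrightarrow> \<iota> (M - 1 - i) = N - 1 - \<iota> i" "\<And>i. i < M \<Longrightarrow> \<epsilon> (\<iota> i) = \<epsilon>' i"
    and X: "X \<in> form_algebra M (anti_form M \<epsilon>')"
  shows "extend_mat \<iota> M N X \<in> form_algebra N (anti_form N \<epsilon>)"
  unfolding form_algebra_anti_form
proof (intro conjI allI impI)
  fix p q assume pq: "p < N" "q < N"
  have img: "N - 1 - p \<in> \<iota> ` {..<M}" if "p \<in> \<iota> ` {..<M}" for p
  proof -
    from that obtain i where "i < M" "p = \<iota> i" by blast
    then show ?thesis using opp(1)[of i] by (intro image_eqI[of _ _ "M - 1 - i"]) auto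
  qed
  have img': "N - 1 - p \<in> \<iota> ` {..<M} \<longleftrightarrow> p \<in> \<iota> ` {..<M}" if "p < N" for p
    using img[of p] img[of "N - 1 - p"] that by auto
  show "\<epsilon> p * extend_mat \<iota> M N X $$ (p, q) + \<epsilon> q * extend_mat \<iota> M N X $$ (N - 1 - q, N - 1 - p) = 0"
  proof (cases "p \<in> \<iota> ` {..<M} \<and> q \<in> \<iota> ` {..<M}")
    case True
    then obtain i j where ij: "i < M" "p = \<iota> i" "j < M" "q = \<iota> j" by blast
    have "extend_mat \<iota> M N X $$ (\<iota> i, \<iota> j) = X $$ (i, j)"
      "extend_mat \<iota> M N X $$ (\<iota> (M - 1 - j), \<iota> (M - 1 - i)) = X $$ (M - 1 - j, M - 1 - i)"
      using ij by (auto intro!: extend_mat_index(1)[OF \<iota>])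
    then show ?thesis
      using X ij by (simp add: opp[simplified] form_algebra_anti_form)
  next
    case False
    then have "N - 1 - q \<notin> \<iota> ` {..<M} \<or> N - 1 - p \<notin> \<iota> ` {..<M}"
      using pq img' by blast
    moreover have "N - 1 - q < N" "N - 1 - p < N" using pq by auto
    ultimately have "extend_mat \<iota> M N X $$ (N - 1 - q, N - 1 - p) = 0"
      by (intro extend_mat_index(2)[OF \<iota>])
    moreover have "extend_mat \<iota> M N X $$ (p, q) = 0"
      using False pq by (intro extend_mat_index(2)[OF \<iota>]) auto
    ultimately show ?thesis by (simp only: mult_zero_right add_0_left)
  qed
qed (simp add: extend_mat_def)

text \<open>A matrix unit minus its signed mirror image in the antidiagonal. For a position on the
  antidiagonal the two coincide and the entry is \<open>1 - \<tau>\<close>, that is 0 or 2; hence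
  the side condition under which the entry at \<open>(i, j)\<close> is 1.\<close>

definition skew_unit :: "nat \<Rightarrow> nat \<Rightarrow> complex mat" where
  "skew_unit i j = mat N N (\<lambda>(p, q). (if p = i \<and> q = j then 1 else 0) -
    \<epsilon> p * \<epsilon> q * (if N - 1 - q = i \<and> N - 1 - p = j then 1 else 0))"

lemma skew_unit_in_form_algebra: "skew_unit i j \<in> form_algebra N (anti_form N \<epsilon>)"
  unfolding form_algebra_anti_form
proof (intro conjI allI impI)
  fix p q assume pq: "p < N" "q < N"
  define y :: "nat \<Rightarrow> nat \<Rightarrow> complex" where "y p q = (if p = i \<and> q = j then 1 else 0)" for p q
  have "\<epsilon> p * skew_unit i j $$ (p, q) + \<epsilon> q * skew_unit i j $$ (N - 1 - q, N - 1 - p) =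
      \<epsilon> p * (y p q - \<epsilon> p * \<epsilon> q * y (N - 1 - q) (N - 1 - p)) +
      \<epsilon> q * (y (N - 1 - q) (N - 1 - p) - (\<tau> * \<epsilon> q) * (\<tau> * \<epsilon> p) * y p q)"
    using pq by (auto simp: skew_unit_def y_def sign_opposite[simplified])
  also have "\<dots> = 0"
    using sign[of p] sign[of q] tau_square[OF pq(1)] by (auto simp: algebra_simps)
  finally show "\<epsilon> p * skew_unit i j $$ (p, q) + \<epsilon> q * skew_unit i j $$ (N - 1 - q, N - 1 - p) = 0" .
qed (simp add: skew_unit_def)

lemma skew_unit_eq_1:
  "i < N \<Longrightarrow> j < N \<Longrightarrow> N - 1 - j \<noteq> i \<Longrightarrow> skew_unit i j $$ (i, j) = 1"
  by (simp add: skew_unit_def)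

lemma skew_unit_eq_0:
  "p < N \<Longrightarrow> q < N \<Longrightarrow> p \<noteq> i \<or> q \<noteq> j \<Longrightarrow> N - 1 - q \<noteq> i \<or> N - 1 - p \<noteq> j \<Longrightarrow>
    skew_unit i j $$ (p, q) = 0"
  by (auto simp: skew_unit_def)

lemma strictly_upper_skew_unit: "i < j \<Longrightarrow> strictly_upper (skew_unit i j)"
  by (auto simp: strictly_upper_def skew_unit_def)

end



lemma eventually_constant_of_antimono:
  fixes d :: "nat \<Rightarrow> nat"
  assumes "\<And>n. n \<ge> n0 \<Longrightarrow> d (Suc n) \<le> d n"
  shows "\<exists>m n1. n1 \<ge> n0 \<and> (\<forall>n\<ge>n1. d n = m)"
proof -
  define m where "m = (LEAST m. \<exists>n\<ge>n0. d n = m)"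
  have "\<exists>n\<ge>n0. d n = m" unfolding m_def by (rule LeastI[of _ "d n0"]) auto
  then obtain n1 where n1: "n1 \<ge> n0" "d n1 = m" by blast
  have "d n = m" if "n \<ge> n1" for n
  proof (rule antisym)
    show "d n \<le> m"
      using that
    proof (induction rule: dec_induct)
      case (step n)
      then show ?case using assms[of n] n1(1) by linarith
    qed (simp add: n1)
    have "\<exists>n'\<ge>n0. d n' = d n" using that n1 by (intro exI[of _ n]) auto
    then show "m \<le> d n" unfolding m_def by (rule Least_le)
  qed
  then show ?thesis using n1 by blast
qed

section \<open>Embeddings between consecutive ranks\<close>

text \<open>Here \<open>n\<close> is the matrix size. Omitting \<open>Suc k\<close> leaves
  \<open>k + 1\<close> indices before it and, by the bound on \<open>n\<close>, at least
  \<open>k + 1\<close> after it. So on either side some index avoids \<open>S\<close>, and ordinary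
  matrix units off the diagonal serve as rows and columns.\<close>

lemma rank_step_sl:
  assumes "2 * k + 2 \<le> n"
  shows "rank_step n (Suc n) (sl_algebra n) (sl_algebra (Suc n))
    (\<lambda>i. if i < Suc k then i else Suc i) {Suc k} k"
proof
  let ?\<iota> = "\<lambda>i. if i < Suc k then i else Suc i"
  show "sl_algebra n \<subseteq> carrier_mat n n" "sl_algebra (Suc n) \<subseteq> carrier_mat (Suc n) (Suc n)"
    by (auto simp: sl_algebra_def)
  show "?\<iota> i < ?\<iota> j" if "i < j" for i j using that by auto
  have inj: "inj_on ?\<iota> {..<n}" by (auto simp: inj_on_def split: if_splits)
  show range: "?\<iota> ` {..<n} = {..<Suc n} - {Suc k}"
  proof (intro equalityI subsetI)
    fix p assume p: "p \<in> {..<Suc n} - {Suc k}"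
    show "p \<in> ?\<iota> ` {..<n}"
      by (rule image_eqI[of _ _ "if p < Suc k then p else p - 1"]) (use p assms in auto)
  qed (use assms in \<open>auto split: if_splits\<close>)
  show "\<exists>X'\<in>sl_algebra (Suc n). (\<forall>i<n. \<forall>j<n. X' $$ (?\<iota> i, ?\<iota> j) = X $$ (i, j)) \<and>
      (\<forall>i<Suc n. \<forall>j<Suc n. i \<in> {Suc k} \<or> j \<in> {Suc k} \<longrightarrow> X' $$ (i, j) = 0)"
    if "X \<in> sl_algebra n" for X
  proof (intro bexI[of _ "extend_mat ?\<iota> n (Suc n) X"] conjI allI impI)
    have sub: "?\<iota> ` {..<n} \<subseteq> {..<Suc n}" using range by blast
    show "extend_mat ?\<iota> n (Suc n) X \<in> sl_algebra (Suc n)" by (rule sl_algebra_extend_mat[OF inj sub that])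
    show "extend_mat ?\<iota> n (Suc n) X $$ (?\<iota> i, ?\<iota> j) = X $$ (i, j)" if "i < n" "j < n" for i j
      using that by (rule extend_mat_index(1)[OF inj sub])
    show "extend_mat ?\<iota> n (Suc n) X $$ (i, j) = 0"
      if "i < Suc n" "j < Suc n" "i \<in> {Suc k} \<or> j \<in> {Suc k}" for i j
      using that range by (intro extend_mat_index(2)[OF inj sub]) auto
  qed
  define E :: "nat \<Rightarrow> nat \<Rightarrow> complex mat"
    where "E i j = mat (Suc n) (Suc n) (\<lambda>(p, q). if p = i \<and> q = j then 1 else 0)" for i j
  have E: "E i j \<in> sl_algebra (Suc n)" "strictly_upper (E i j)" if "i < j" for i j
    using that by (auto simp: E_def sl_algebra_def strictly_upper_def intro!: sum.neutral)
  fix x :: nat and S :: "nat set"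
  assume x: "x \<in> {Suc k}" and S: "finite S" "card S \<le> k"
  have "\<not> {..k} \<subseteq> S" using card_mono[OF S(1), of "{..k}"] S(2) by auto
  then obtain i where i: "i \<le> k" "i \<notin> S" by auto
  \<comment> \<open>A column requires a fresh index after the omitted one, a row one before it, as
    the matrix unit must be strictly upper triangular.\<close>
  have "\<not> {Suc (Suc k)..n} \<subseteq> S"
    using card_mono[OF S(1), of "{Suc (Suc k)..n}"] S(2) assms by auto
  then obtain j where j: "Suc (Suc k) \<le> j" "j \<le> n" "j \<notin> S"
    by (meson atLeastAtMost_iff subsetI)
  show "\<exists>i X. i < Suc n \<and> i \<notin> {Suc k} \<and> X \<in> sl_algebra (Suc n) \<and> strictly_upper X \<and>
      (\<forall>v<Suc n. X $$ (i, v) = (if v = x then 1 else 0)) \<and>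
      (\<forall>v\<in>S. \<forall>w\<in>{Suc k}. v < Suc n \<longrightarrow> w < Suc n \<longrightarrow> X $$ (v, w) = 0 \<and> X $$ (w, v) = 0)"
    using i x E[of i x] assms by (intro exI[of _ i] exI[of _ "E i x"]) (auto simp: E_def)
  show "\<exists>i X. i < Suc n \<and> i \<notin> {Suc k} \<and> X \<in> sl_algebra (Suc n) \<and> strictly_upper X \<and>
      (\<forall>v<Suc n. X $$ (v, i) = (if v = x then 1 else 0)) \<and>
      (\<forall>v\<in>S. \<forall>w\<in>{Suc k}. v < Suc n \<longrightarrow> w < Suc n \<longrightarrow> X $$ (v, w) = 0 \<and> X $$ (w, v) = 0)"
    using j x E[of x j] assms by (intro exI[of _ j] exI[of _ "E x j"]) (auto simp: E_def)
qed

text \<open>The omitted pair is exchanged by the reversal \<open>i \<mapsto> N + 1 - i\<close>, so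
  the embedding commutes with reversal. A fresh \<open>i < m\<close> gives the row element
  \<open>skew_unit i x\<close>; its mirror index \<open>N + 1 - i\<close> lies beyond the omitted
  pair and gives the column element \<open>skew_unit x (N + 1 - i)\<close>.\<close>

lemma rank_step_form:
  fixes m N k \<epsilon> \<epsilon>' \<tau>
  defines "\<iota> \<equiv> \<lambda>i. if i < m then i else if i < N - m then i + 1 else i + 2"
  assumes signs: "anti_form_signs (N + 2) \<epsilon>' \<tau>" and m: "2 * k < m" "2 * m \<le> N"
    and ext: "\<And>i. i < N \<Longrightarrow> \<epsilon>' (\<iota> i) = \<epsilon> i"
  shows "rank_step N (N + 2) (form_algebra N (anti_form N \<epsilon>)) (form_algebra (N + 2) (anti_form (N + 2) \<epsilon>'))
    \<iota> {m, N + 1 - m} k"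
proof -
  interpret anti_form_signs "N + 2" \<epsilon>' \<tau> by (rule signs)
  let ?L = "form_algebra N (anti_form N \<epsilon>)" and ?L' = "form_algebra (N + 2) (anti_form (N + 2) \<epsilon>')"
  let ?B = "{m, N + 1 - m}"
  show ?thesis
  proof
    show "?L \<subseteq> carrier_mat N N" "?L' \<subseteq> carrier_mat (N + 2) (N + 2)"
      by (auto simp: form_algebra_def)
    show "\<iota> i < \<iota> j" if "i < j" for i j using that by (auto simp: \<iota>_def)
    have inj: "inj_on \<iota> {..<N}" by (auto simp: inj_on_def \<iota>_def split: if_splits)
    show range: "\<iota> ` {..<N} = {..<N + 2} - ?B"
    proof (intro equalityI subsetI)
      fix p assume p: "p \<in> {..<N + 2} - ?B"
      show "p \<in> \<iota> ` {..<N}"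
        by (rule image_eqI[of _ _ "if p < m then p else if p < N + 1 - m then p - 1 else p - 2"])
          (use p m in \<open>auto simp: \<iota>_def\<close>)
    qed (use m in \<open>auto simp: \<iota>_def split: if_splits\<close>)
    show "\<exists>X'\<in>?L'. (\<forall>i<N. \<forall>j<N. X' $$ (\<iota> i, \<iota> j) = X $$ (i, j)) \<and>
        (\<forall>i<N + 2. \<forall>j<N + 2. i \<in> ?B \<or> j \<in> ?B \<longrightarrow> X' $$ (i, j) = 0)"
      if "X \<in> ?L" for X
    proof (intro bexI[of _ "extend_mat \<iota> N (N + 2) X"] conjI allI impI)
      have sub: "\<iota> ` {..<N} \<subseteq> {..<N + 2}" using range by blast
      have opp: "\<iota> (N - 1 - i) = N + 2 - 1 - \<iota> i" if "i < N" for i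
        using that m by (auto simp: \<iota>_def)
      show "extend_mat \<iota> N (N + 2) X \<in> ?L'"
        by (rule form_algebra_extend_mat[OF inj sub opp ext that])
      show "extend_mat \<iota> N (N + 2) X $$ (\<iota> i, \<iota> j) = X $$ (i, j)" if "i < N" "j < N" for i j
        using that by (rule extend_mat_index(1)[OF inj sub])
      show "extend_mat \<iota> N (N + 2) X $$ (i, j) = 0"
        if "i < N + 2" "j < N + 2" "i \<in> ?B \<or> j \<in> ?B" for i j
        using that range by (intro extend_mat_index(2)[OF inj sub]) auto
    qed
    fix x :: nat and S :: "nat set"
    assume x: "x \<in> ?B" and S: "finite S" "card S \<le> k"
    \<comment> \<open>A skew unit also involves the mirror index \<open>N + 1 - i\<close>, so both
      \<open>i\<close> and its mirror must avoid \<open>S\<close>. This excludes at most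
      \<open>2 * k\<close> values, fewer than \<open>m\<close>.\<close>
    let ?S = "S \<union> (\<lambda>v. N + 1 - v) ` S"
    have "card ?S \<le> card S + card S"
      using card_Un_le[of S "(\<lambda>v. N + 1 - v) ` S"] card_image_le[OF S(1), of "\<lambda>v. N + 1 - v"] by linarith
    then have "card ?S < m" using S(2) m(1) by linarith
    then have "\<not> {..<m} \<subseteq> ?S" using card_mono[of ?S "{..<m}"] S(1) by auto
    then obtain i where "i < m" "i \<notin> ?S" by auto
    moreover from this have "N + 1 - i \<notin> S"
      using m(2) by (auto simp: image_iff)
    ultimately have i: "i < m" "i \<notin> S" "N + 1 - i \<notin> S" by auto
    show "\<exists>i X. i < N + 2 \<and> i \<notin> ?B \<and> X \<in> ?L' \<and> strictly_upper X \<and>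
        (\<forall>v<N + 2. X $$ (i, v) = (if v = x then 1 else 0)) \<and>
        (\<forall>v\<in>S. \<forall>w\<in>?B. v < N + 2 \<longrightarrow> w < N + 2 \<longrightarrow> X $$ (v, w) = 0 \<and> X $$ (w, v) = 0)"
    proof (intro exI conjI ballI allI impI)
      show "i < N + 2" "i \<notin> ?B" using i m by auto
      show "skew_unit i x \<in> ?L'" by (rule skew_unit_in_form_algebra)
      show "strictly_upper (skew_unit i x)" by (rule strictly_upper_skew_unit) (use i x m in auto)
      show "skew_unit i x $$ (i, v) = (if v = x then 1 else 0)" if "v < N + 2" for v
      proof (cases "v = x")
        case True
        have "skew_unit i x $$ (i, x) = 1" by (rule skew_unit_eq_1) (use i x m in auto)
        then show ?thesis using True by (simp only: simp_thms if_True)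
      next
        case False
        have "skew_unit i x $$ (i, v) = 0"
          by (rule skew_unit_eq_0) (use False that i x m in auto)
        then show ?thesis using False by (simp only: if_False)
      qed
      fix v w assume vw: "v \<in> S" "w \<in> ?B" "v < N + 2" "w < N + 2"
      \<comment> \<open>Both nonzero entries of the skew unit have \<open>i\<close> as row or
        \<open>N + 1 - i\<close> as column, and neither \<open>v\<close> nor \<open>w\<close> takes
        these values.\<close>
      have v: "v \<noteq> i" "v \<noteq> N + 1 - i" using i vw(1) by auto
      moreover from v have "N + 2 - 1 - v \<noteq> i" "N + 2 - 1 - v \<noteq> N + 1 - i"
        using i(1) vw(3) m by auto
      moreover have "w \<noteq> i" "w \<noteq> N + 1 - i" "N + 2 - 1 - w \<noteq> i" "N + 2 - 1 - w \<noteq> N + 1 - i"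
        using i vw(2) m by auto
      ultimately show "skew_unit i x $$ (v, w) = 0" "skew_unit i x $$ (w, v) = 0"
        using vw(3,4) by (blast intro: skew_unit_eq_0)+
    qed
    show "\<exists>i X. i < N + 2 \<and> i \<notin> ?B \<and> X \<in> ?L' \<and> strictly_upper X \<and>
        (\<forall>v<N + 2. X $$ (v, i) = (if v = x then 1 else 0)) \<and>
        (\<forall>v\<in>S. \<forall>w\<in>?B. v < N + 2 \<longrightarrow> w < N + 2 \<longrightarrow> X $$ (v, w) = 0 \<and> X $$ (w, v) = 0)"
    proof (intro exI conjI ballI allI impI)
      show "N + 1 - i < N + 2" "N + 1 - i \<notin> ?B" using i m by auto
      show "skew_unit x (N + 1 - i) \<in> ?L'" by (rule skew_unit_in_form_algebra)
      show "strictly_upper (skew_unit x (N + 1 - i))" by (rule strictly_upper_skew_unit) (use i x m in auto)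
      show "skew_unit x (N + 1 - i) $$ (v, N + 1 - i) = (if v = x then 1 else 0)" if "v < N + 2" for v
      proof (cases "v = x")
        case True
        have "skew_unit x (N + 1 - i) $$ (x, N + 1 - i) = 1" by (rule skew_unit_eq_1) (use i x m in auto)
        then show ?thesis using True by (simp only: simp_thms if_True)
      next
        case False
        have "skew_unit x (N + 1 - i) $$ (v, N + 1 - i) = 0"
          by (rule skew_unit_eq_0) (use False that i x m in auto)
        then show ?thesis using False by (simp only: if_False)
      qed
      fix v w assume vw: "v \<in> S" "w \<in> ?B" "v < N + 2" "w < N + 2"
      have v: "v \<noteq> i" "v \<noteq> N + 1 - i" using i vw(1) by auto
      moreover from v have "N + 2 - 1 - v \<noteq> i" "N + 2 - 1 - v \<noteq> N + 1 - i"
        using i(1) vw(3) m by auto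
      moreover have "w \<noteq> i" "w \<noteq> N + 1 - i" "N + 2 - 1 - w \<noteq> i" "N + 2 - 1 - w \<noteq> N + 1 - i"
        using i vw(2) m by auto
      ultimately show "skew_unit x (N + 1 - i) $$ (v, w) = 0" "skew_unit x (N + 1 - i) $$ (w, v) = 0"
        using vw(3,4) by (blast intro: skew_unit_eq_0)+
    qed
  qed
qed


section \<open>The four types together\<close>

definition closed_under_parts :: "nat \<Rightarrow> complex mat set \<Rightarrow> bool" where
  "closed_under_parts N L \<longleftrightarrow> L \<subseteq> carrier_mat N N \<and> (\<forall>X\<in>L. \<forall>Y\<in>L. X + Y \<in> L) \<and>
    (\<forall>X\<in>L. conj_transpose X \<in> L) \<and>
    (\<forall>X\<in>L. mat_part (\<lambda>i j. j < i) X \<in> L \<and> mat_part (=) X \<in> L \<and> mat_part (<) X \<in> L)"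

lemma closed_under_parts_sl_algebra: "closed_under_parts N (sl_algebra N)"
  unfolding closed_under_parts_def
  by (auto intro!: sl_algebra_add sl_algebra_conj_transpose sl_algebra_part) (auto simp: sl_algebra_def)

lemma closed_under_parts_form_algebra:
  assumes "anti_form_signs N \<epsilon> \<tau>"
  shows "closed_under_parts N (form_algebra N (anti_form N \<epsilon>))"
proof -
  interpret anti_form_signs N \<epsilon> \<tau> by (rule assms)
  show ?thesis
    unfolding closed_under_parts_def
  proof (intro conjI ballI)
    show "form_algebra N (anti_form N \<epsilon>) \<subseteq> carrier_mat N N" by (auto simp: form_algebra_def)
  qed (auto intro!: form_algebra_add form_algebra_conj_transpose form_algebra_part)
qed

lemma anti_form_signs_sym: "anti_form_signs N (\<lambda>_. 1) 1"
  by unfold_locales auto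

lemma anti_form_signs_alt: "anti_form_signs (2 * n) (\<lambda>i. if 2 * i + 1 < 2 * n then 1 else - 1) (- 1)"
proof
  fix i assume "i < 2 * n"
  then show "(if 2 * (2 * n - 1 - i) + 1 < 2 * n then 1 else - 1) =
      - 1 * (if 2 * i + 1 < 2 * n then 1 else - 1 :: complex)"
    by (cases "i < n") auto
qed simp

lemma closed_under_parts_classical_algebra: "closed_under_parts (natural_dim t n) (classical_algebra t n)"
  using anti_form_signs_sym anti_form_signs_alt
  by (cases t)
    (auto simp: sym_form_eq alt_form_eq
      intro!: closed_under_parts_sl_algebra closed_under_parts_form_algebra)

text \<open>In types B, C and D the step is applied with \<open>m = n\<close>. In types C and D the
  omitted pair is then the middle one; in type B it surrounds the middle index, which is its own
  mirror and stays. For type A the matrix size is \<open>Suc n\<close>.\<close>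

lemma ex_rank_step_classical:
  assumes "n \<ge> 2 * k + 2"
  shows "\<exists>\<iota> B. rank_step (natural_dim t n) (natural_dim t (Suc n))
    (classical_algebra t n) (classical_algebra t (Suc n)) \<iota> B k"
proof (cases t)
  case Type_A
  then show ?thesis using rank_step_sl[of k "Suc n"] assms by auto
next
  case Type_B
  have "rank_step (2 * n + 1) (2 * n + 1 + 2) (form_algebra (2 * n + 1) (anti_form (2 * n + 1) (\<lambda>_. 1)))
    (form_algebra (2 * n + 1 + 2) (anti_form (2 * n + 1 + 2) (\<lambda>_. 1)))
    (\<lambda>i. if i < n then i else if i < 2 * n + 1 - n then i + 1 else i + 2) {n, 2 * n + 1 + 1 - n} k"
    using assms by (intro rank_step_form[OF anti_form_signs_sym]) auto
  then show ?thesis using Type_B by (auto simp: sym_form_eq)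
next
  case Type_C
  have "rank_step (2 * n) (2 * n + 2)
    (form_algebra (2 * n) (anti_form (2 * n) (\<lambda>i. if 2 * i + 1 < 2 * n then 1 else - 1)))
    (form_algebra (2 * n + 2) (anti_form (2 * n + 2) (\<lambda>i. if 2 * i + 1 < 2 * Suc n then 1 else - 1)))
    (\<lambda>i. if i < n then i else if i < 2 * n - n then i + 1 else i + 2) {n, 2 * n + 1 - n} k"
    using assms anti_form_signs_alt[of "Suc n"]
    by (intro rank_step_form[of _ _ "- 1"]) (auto simp: algebra_simps)
  then show ?thesis using Type_C by (auto simp: alt_form_eq)
next
  case Type_D
  have "rank_step (2 * n) (2 * n + 2) (form_algebra (2 * n) (anti_form (2 * n) (\<lambda>_. 1)))
    (form_algebra (2 * n + 2) (anti_form (2 * n + 2) (\<lambda>_. 1)))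
    (\<lambda>i. if i < n then i else if i < 2 * n - n then i + 1 else i + 2) {n, 2 * n + 1 - n} k"
    using assms by (intro rank_step_form[OF anti_form_signs_sym]) auto
  then show ?thesis using Type_D by (auto simp: sym_form_eq)
qed

theorem proposition2p1:
  fixes t :: classical_type and a b c k :: nat
  assumes "a > 0" and "b > 0" and "c > 0" and "k > 0"
  shows "\<exists>len::nat. \<exists>n0. \<forall>n\<ge>n0.
    module_length (classical_algebra t n)
      (tensor_power k
        (direct_sum
          (direct_sum
            (direct_power a (natural_module (natural_dim t n)))
            (direct_power b (dual_module (natural_module (natural_dim t n)))))
          (direct_power c trivial_module))) = enat len"
proof -
  define T where "T n = tensor_power k (mixed_module a b c (natural_dim t n))" for n
  define d where "d n = fscale.dim (hw_space (classical_algebra t n) (T n))" for n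
  have len: "module_length (classical_algebra t n) (T n) = enat (d n)" for n
    unfolding d_def T_def
  proof (rule unitary_module.module_length_eq_dim_hw[OF unitary_module_tensor_mixed])
    show "X * Y - Y * X \<in> classical_algebra t n"
      if "X \<in> classical_algebra t n" "Y \<in> classical_algebra t n" for X Y
      using that by (rule classical_algebra_bracket)
    show "\<exists>Y D Z. Y \<in> classical_algebra t n \<and> strictly_lower Y \<and> D \<in> classical_algebra t n \<and>
        diagonal_mat D \<and> Z \<in> classical_algebra t n \<and> strictly_upper Z \<and> X = Y + D + Z"
      if "X \<in> classical_algebra t n" for X
      using that closed_under_parts_classical_algebra[of t n]
      by (intro triangular_parts[of _ "natural_dim t n"]) (auto simp: closed_under_parts_def)
  qed (use closed_under_parts_classical_algebra[of t n] in \<open>auto simp: closed_under_parts_def\<close>)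
  \<comment> \<open>Only this inequality is established for consecutive ranks; equality for large
    \<open>n\<close> follows from the well-ordering of the natural numbers.\<close>
  have "d (Suc n) \<le> d n" if n: "n \<ge> 2 * k + 2" for n
  proof -
    obtain \<iota> B where "rank_step (natural_dim t n) (natural_dim t (Suc n))
        (classical_algebra t n) (classical_algebra t (Suc n)) \<iota> B k"
      using ex_rank_step_classical[OF n] by blast
    then show ?thesis
      unfolding d_def T_def
      by (rule rank_step.dim_hw_space_le)
        (unfold mixed_module_def, rule lie_module_classical)
  qed
  then obtain m n1 where "\<forall>n\<ge>n1. d n = m"
    using eventually_constant_of_antimono[of "2 * k + 2" d] by blast
  then have "\<forall>n\<ge>n1. module_length (classical_algebra t n) (T n) = enat m" by (simp add: len)
  then show ?thesis unfolding T_def mixed_module_def by blast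
qed

end
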